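(* Let $T:[0,1]\to[0,1]$ be a Lorenz-like cusp map as described in the context (including conditions (i)–(iii) there), let $\mu$ be its unique absolutely continuous invariant probability measure, let $\rho$ be the density of $\mu$, and set $B^*:=\max(B,B')$. Then there are constants $c',c''>0$ such that $$\rho(x)=c'x^a+o(x^a),\quad x\to0^+,\ a>0,$$ $$\rho(x)=c''(1-x)^b+o((1-x)^b),\quad x\to1^-,\ b>0,$$ with $$a=b=\frac1{B^*}-1,$$ and the constants $c'$ and $c''$ verify $$\left(\frac1{\alpha'}\right)^{\frac1{B^*}}+\left(\frac{1}{\alpha\left(\frac{c'}{c''}\right)^{B^*}}\right)^{\frac1{B^*}}=1 .$$
   Context: **The map.** $T:[0,1]\to[0,1]$ is a Markov map with a cusp at $x_0\in(0,1)$. The left branch $T_1:=T|_{[0,x_0]}$ is monotonically increasing, convex and uniformly expanding (also at the fixed point $0$). The right branch $T_2:=T|_{[x_0,1]}$ is monotonically decreasing and convex, with $|DT|$ bounded from below by a positive constant less than one. Both branches are onto $[0,1]$. The left and right derivatives blow up at $x_0$. $T$ is $C^1$ on $[0,1]\setminus\{x_0\}$ (one-sided derivatives at $0,1$) and of class $C^{1+\iota}$, for some $\iota\in(0,1)$, on $(0,x_0)\cup(x_0,1)$ (i.e. $DT$ is locally $\iota$-Hölder there). The local behaviors are as follows ($c$ denotes a positive constant that may differ from line to line): - as $x\to0^+$: $T(x)=\alpha'x+\beta'x^{1+\psi}+o(x^{1+\psi})$, $DT(x)=\alpha'+cx^{\psi}+o(x^\psi)$, with $\alpha'>1$, $\beta'>0$,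 $\psi>1$; - as $x\to1^-$: $T(x)=\alpha(1-x)+\tilde\beta(1-x)^{1+\kappa}+o((1-x)^{1+\kappa})$, $DT(x)=-\alpha-c(1-x)^\kappa+o((1-x)^\kappa)$, with $0<\alpha<1$, $\tilde\beta>0$, $\kappa>1$; - as $x\to x_0^-$: $T(x)=1-A'(x_0-x)^{B'}+o((x_0-x)^{B'})$, $DT(x)=c(x_0-x)^{B'-1}+o((x_0-x)^{B'-1})$, with $A'>0$, $0<B'<1$; - as $x\to x_0^+$: $T(x)=1-A(x-x_0)^{B}+o((x-x_0)^{B})$, $DT(x)=-c(x-x_0)^{B-1}+o((x-x_0)^{B-1})$, with $A>0$, $0<B<1$. **Preimages of $x_0$.** $a_0:=T_2^{-1}x_0$, $a_0':=T_1^{-1}x_0$, and for $p\ge1$: $a_p':=T_1^{-p}a_0'$ and $a_p:=T_2^{-1}T_1^{-(p-1)}a_0'$. The point $b_1\in(x_0,a_0)$ is defined by $Tb_1=a_0$. **Further standing conditions on $T$.** (i) $d_{(1,0)}:=\inf_{x\in(b_1,a_0)}|DT(x)|>1$; (ii) $|DT(b_1)|\ge DT(a_0')$; (iii) for some $\alpha''$ with $1<\alpha''\le\min\{d_{(1,0)},\alpha'\}$, $|DT(a_{p-1})|\,DT(a'_{p-2})\cdots DT(a'_0)>\alpha''$ for all integers $1<p\le p^*:=\lfloor 1+\log(\alpha''\alpha^{-1})/\log\alpha'\rfloor$. Under these conditions $T$ admits a unique invariant probability measure $\mu$ absolutely continuous with respect to Lebesgue measure on $[0,1]$. Its density $\rho$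 is defined up to Lebesgue-null sets, and pointwise statements refer to a suitable (continuous) version of $\rho$. *)

theory Defs
  imports "HOL-Analysis.Analysis" "HOL-Library.Landau_Symbols" "HOL-Probability.Probability_Measure"
begin

definition locally_hoelder_on :: "real \<Rightarrow> real set \<Rightarrow> (real \<Rightarrow> real) \<Rightarrow> bool" where
  "locally_hoelder_on \<iota> S f \<longleftrightarrow>
     (\<forall>x\<in>S. \<exists>\<epsilon>>0. \<exists>C. \<forall>y\<in>ball x \<epsilon> \<inter> S. \<forall>z\<in>ball x \<epsilon> \<inter> S. \<bar>f y - f z\<bar> \<le> C * \<bar>y - z\<bar> powr \<iota>)"

(* The function DT is the derivative of T on [0,1] - {x0}, one-sided at 0 and 1; its value at x0
   is irrelevant. The constants c in the expansions of DT are unrelated to one another, hence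
   each is quantified on its own. *)
locale cusp_map =
  fixes T DT :: "real \<Rightarrow> real"
    and x\<^sub>0 \<alpha>' \<beta>' \<psi> \<alpha> \<beta> \<kappa> A' B' A B :: real
  assumes x0: "x\<^sub>0 \<in> {0<..<1}"
    and left_onto: "T ` {0..x\<^sub>0} = {0..1}"
    and left_mono: "mono_on {0..x\<^sub>0} T"
    and left_convex: "convex_on {0..x\<^sub>0} T"
    and left_expanding: "\<exists>\<gamma>>1. \<forall>x\<in>{0..<x\<^sub>0}. \<gamma> \<le> DT x"
    and right_onto: "T ` {x\<^sub>0..1} = {0..1}"
    and right_antimono: "antimono_on {x\<^sub>0..1} T"
    and right_convex: "convex_on {x\<^sub>0..1} T"
    and right_lower_bound: "\<exists>\<gamma>. 0 < \<gamma> \<and> \<gamma> < 1 \<and> (\<forall>x\<in>{x\<^sub>0<..1}. \<gamma> \<le> \<bar>DT x\<bar>)"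
    and deriv: "\<And>x. x \<in> {0..1} - {x\<^sub>0} \<Longrightarrow> (T has_real_derivative DT x) (at x within {0..1})"
    and deriv_continuous: "continuous_on ({0..1} - {x\<^sub>0}) DT"
    and deriv_hoelder: "\<exists>\<iota>. 0 < \<iota> \<and> \<iota> < 1 \<and> locally_hoelder_on \<iota> ({0<..<1} - {x\<^sub>0}) DT"
    and blowup_left: "filterlim DT at_top (at_left x\<^sub>0)"
    and blowup_right: "filterlim DT at_bot (at_right x\<^sub>0)"
    and params_0: "\<alpha>' > 1" "\<beta>' > 0" "\<psi> > 1"
    and T_at_0: "(\<lambda>x. T x - (\<alpha>' * x + \<beta>' * x powr (1 + \<psi>))) \<in> o[at_right 0](\<lambda>x. x powr (1 + \<psi>))"
    and DT_at_0: "\<exists>c>0. (\<lambda>x. DT x - (\<alpha>' + c * x powr \<psi>)) \<in> o[at_right 0](\<lambda>x. x powr \<psi>)"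
    and params_1: "0 < \<alpha>" "\<alpha> < 1" "\<beta> > 0" "\<kappa> > 1"
    and T_at_1: "(\<lambda>x. T x - (\<alpha> * (1 - x) + \<beta> * (1 - x) powr (1 + \<kappa>)))
                   \<in> o[at_left 1](\<lambda>x. (1 - x) powr (1 + \<kappa>))"
    and DT_at_1: "\<exists>c>0. (\<lambda>x. DT x - (- \<alpha> - c * (1 - x) powr \<kappa>)) \<in> o[at_left 1](\<lambda>x. (1 - x) powr \<kappa>)"
    and params_left: "A' > 0" "0 < B'" "B' < 1"
    and T_left: "(\<lambda>x. T x - (1 - A' * (x\<^sub>0 - x) powr B')) \<in> o[at_left x\<^sub>0](\<lambda>x. (x\<^sub>0 - x) powr B')"
    and DT_left: "\<exists>c>0. (\<lambda>x. DT x - c * (x\<^sub>0 - x) powr (B' - 1))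
                    \<in> o[at_left x\<^sub>0](\<lambda>x. (x\<^sub>0 - x) powr (B' - 1))"
    and params_right: "A > 0" "0 < B" "B < 1"
    and T_right: "(\<lambda>x. T x - (1 - A * (x - x\<^sub>0) powr B)) \<in> o[at_right x\<^sub>0](\<lambda>x. (x - x\<^sub>0) powr B)"
    and DT_right: "\<exists>c>0. (\<lambda>x. DT x - (- c * (x - x\<^sub>0) powr (B - 1)))
                     \<in> o[at_right x\<^sub>0](\<lambda>x. (x - x\<^sub>0) powr (B - 1))"
begin

definition left_inv :: "real \<Rightarrow> real" where
  "left_inv = the_inv_into {0..x\<^sub>0} T"

definition right_inv :: "real \<Rightarrow> real" where
  "right_inv = the_inv_into {x\<^sub>0..1} T"

(* a' p = T1^(-p) a'_0, where a'_0 = T1^(-1) x0 *)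
definition a' :: "nat \<Rightarrow> real" where
  "a' p = (left_inv ^^ p) (left_inv x\<^sub>0)"

definition a :: "nat \<Rightarrow> real" where
  "a p = (if p = 0 then right_inv x\<^sub>0 else right_inv ((left_inv ^^ (p - 1)) (a' 0)))"

definition b\<^sub>1 :: real where
  "b\<^sub>1 = (THE b. b \<in> {x\<^sub>0<..<a 0} \<and> T b = a 0)"

definition d_10 :: real where
  "d_10 = (INF x\<in>{b\<^sub>1<..<a 0}. \<bar>DT x\<bar>)"

end

locale lorenz_cusp_map = cusp_map +
  assumes d_10_gt_1: "d_10 > 1"
    and DT_b1: "\<bar>DT b\<^sub>1\<bar> \<ge> DT (a' 0)"
    and return_expansion:
      "\<exists>\<alpha>''. 1 < \<alpha>'' \<and> \<alpha>'' \<le> min d_10 \<alpha>' \<and>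
         (\<forall>p::nat. 1 < p \<and> int p \<le> \<lfloor>1 + ln (\<alpha>'' / \<alpha>) / ln \<alpha>'\<rfloor> \<longrightarrow>
            \<bar>DT (a (p - 1))\<bar> * (\<Prod>j = 0..p - 2. DT (a' j)) > \<alpha>'')"

abbreviation lborel01 :: "real measure" where
  "lborel01 \<equiv> restrict_space lborel {0..1}"

definition acip :: "(real \<Rightarrow> real) \<Rightarrow> real measure \<Rightarrow> bool" where
  "acip T \<mu> \<longleftrightarrow> sets \<mu> = sets lborel01 \<and> prob_space \<mu> \<and>
     T \<in> measurable \<mu> \<mu> \<and> distr \<mu> \<mu> T = \<mu> \<and> absolutely_continuous lborel01 \<mu>"

(* Densities are only determined up to null sets. Continuity on the open interval singles out
   the version used for pointwise statements; it determines the values there, and the values at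
   the endpoints play no role. *)
definition continuous_density :: "real measure \<Rightarrow> (real \<Rightarrow> real) \<Rightarrow> bool" where
  "continuous_density \<mu> \<rho> \<longleftrightarrow> \<rho> \<in> borel_measurable lborel01 \<and> (\<forall>x\<in>{0..1}. 0 \<le> \<rho> x) \<and>
     \<mu> = density lborel01 (\<lambda>x. ennreal (\<rho> x)) \<and> continuous_on {0<..<1} \<rho>"

end

theory Submission
  imports Defs
begin

text \<open>
  Let \<open>l\<close> and \<open>r\<close> denote the inverses of the two branches. Since \<open>\<rho>\<close> is continuous on \<open>(0, 1)\<close>,
  differentiating \<open>\<mu> [0, x] = \<mu> [0, l x] + \<mu> [r x, 1]\<close> gives the Perron-Frobenius equation
  \<open>\<rho> x = \<rho> (l x) / DT (l x) + \<rho> (r x) / \<bar>DT (r x)\<bar>\<close> at every point of \<open>(0, 1)\<close>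
  (\<open>perron_frobenius\<close>). Put \<open>q = 1 / Bs - 1\<close>.

  As \<open>x\<close> tends to \<open>1\<close>, both preimages tend to \<open>x\<^sub>0\<close>, and the reciprocals of the derivatives there
  behave like \<open>(1 - x) powr (1 / B' - 1)\<close> and \<open>(1 - x) powr (1 / B - 1)\<close>. Hence
  \<open>\<rho> x / (1 - x) powr q\<close> has a limit \<open>c''\<close>, a positive multiple of \<open>\<rho> x\<^sub>0\<close> (\<open>density_at_1\<close>).

  That \<open>\<rho> x\<^sub>0 > 0\<close> is where the expansion hypotheses enter. Otherwise the Perron-Frobenius equation,
  whose terms are nonnegative, makes the zero set of \<open>\<rho>\<close> in \<open>(0, 1)\<close> backward invariant, so it
  contains \<open>x\<^sub>0\<close>, \<open>b\<^sub>1\<close> and all the points \<open>a p\<close> and \<open>a' p\<close>. An open interval disjoint from the zero set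
  then lies in a single cell of the partition by these points, as do all its images, and each return
  to \<open>[a' 0, a 0]\<close> stretches it at least by a fixed factor greater than \<open>1\<close>, which is impossible
  (\<open>no_gap\<close>). So \<open>\<rho>\<close> would vanish on all of \<open>(0, 1)\<close>.

  As \<open>x\<close> tends to \<open>0\<close>, the right preimage tends to \<open>1\<close> and contributes \<open>(K + o(1)) * x powr q\<close> with
  \<open>K = c'' * (1 / \<alpha>) powr (1 / Bs)\<close>, while dividing the equation by \<open>x powr q\<close> turns the contribution
  of the left preimage \<open>l x\<close> into a multiple of \<open>\<rho> (l x) / (l x) powr q\<close> with factor tending to
  \<open>\<theta> = (1 / \<alpha>') powr (1 / Bs) < 1\<close>. The only possible limit is therefore \<open>c' = K / (1 - \<theta>)\<close>, and this
  is the relation between the constants. That it is the limit follows by comparison: for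
  \<open>D > c'\<close> the function \<open>h x = \<rho> x - D * x powr q\<close> satisfies \<open>h x \<le> h (l x) / DT (l x)\<close> near \<open>0\<close>.
  The positive part of \<open>h\<close> satisfies the same inequality; being integrable, it has no more mass on
  \<open>[0, x]\<close> than on \<open>[0, l x]\<close>, so it vanishes (\<open>subinvariant_zero\<close>). The case \<open>D < c'\<close> is
  symmetric.
\<close>

section \<open>Subinvariant functions near the fixed point\<close>

lemma integral_split:
  fixes f :: "real \<Rightarrow> real"
  assumes "f integrable_on {0..\<delta>}" "0 \<le> u" "u \<le> v" "v \<le> \<delta>"
  shows "integral {0..v} f - integral {0..u} f = integral {u..v} f"
proof -
  have "f integrable_on {0..v}" using assms(1) by (rule integrable_on_subinterval) (use assms in auto)
  from Henstock_Kurzweil_Integration.integral_combine[OF assms(2,3) this] show ?thesis by simp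
qed

lemma indefinite_integral_deriv:
  fixes f :: "real \<Rightarrow> real"
  assumes int: "f integrable_on {0..\<delta>}" and cont: "continuous_on {0<..<\<delta>} f" and x: "x \<in> {0<..<\<delta>}"
  shows "((\<lambda>t. integral {0..t} f) has_real_derivative f x) (at x)"
proof -
  obtain u v where uv: "0 < u" "u < x" "x < v" "v < \<delta>"
    using x dense[of 0 x] dense[of x \<delta>] by auto
  have c: "continuous_on {u..v} f"
    using cont by (rule continuous_on_subset) (use uv in auto)
  have "((\<lambda>t. integral {u..t} f) has_real_derivative f x) (at x within {u..v})"
    by (rule integral_has_real_derivative[OF c]) (use uv in auto)
  then have "((\<lambda>t. integral {0..u} f + integral {u..t} f) has_real_derivative f x) (at x within {u..v})"
    by (auto intro!: derivative_eq_intros)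
  then have "((\<lambda>t. integral {0..u} f + integral {u..t} f) has_real_derivative f x) (at x)"
    using uv by (simp add: at_within_Icc_at)
  then show ?thesis
  proof (rule DERIV_cong_ev[THEN iffD1, rotated -1])
    have "\<forall>\<^sub>F t in nhds x. t \<in> {u<..<v}"
      by (rule eventually_nhds_in_open) (use uv in auto)
    then show "\<forall>\<^sub>F t in nhds x. integral {0..u} f + integral {u..t} f = integral {0..t} f"
    proof eventually_elim
      case (elim t)
      then show ?case using integral_split[OF int, of u t] uv by auto
    qed
  qed auto
qed

text \<open>The hypothesis \<open>sub\<close> says that \<open>U (y x) - U x\<close> is nondecreasing, where \<open>U\<close> is the indefinite
  integral of \<open>f\<close>. This difference tends to \<open>0\<close> at \<open>0\<close>, hence is nonnegative, whereas \<open>y x < x\<close>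
  and \<open>f \<ge> 0\<close> make it nonpositive. So \<open>f\<close> has integral \<open>0\<close> over \<open>[y x, x]\<close>.\<close>

lemma subinvariant_zero:
  fixes f y y' :: "real \<Rightarrow> real" and \<delta> :: real
  assumes int: "f integrable_on {0..\<delta>}"
    and cont: "continuous_on {0<..<\<delta>} f"
    and nonneg: "\<And>x. x \<in> {0..\<delta>} \<Longrightarrow> 0 \<le> f x"
    and y_bounds: "\<And>x. x \<in> {0<..<\<delta>} \<Longrightarrow> 0 < y x \<and> y x < x"
    and y_deriv: "\<And>x. x \<in> {0<..<\<delta>} \<Longrightarrow> (y has_real_derivative y' x) (at x)"
    and sub: "\<And>x. x \<in> {0<..<\<delta>} \<Longrightarrow> f x \<le> f (y x) * y' x"
    and z: "z \<in> {0<..<\<delta>}"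
  shows "f z = 0"
proof -
  define U where "U = (\<lambda>x. integral {0..x} f)"
  have U_cont: "continuous_on {0..\<delta>} U"
    unfolding U_def by (rule indefinite_integral_continuous_1[OF int])
  have U_diff: "U v - U u = integral {u..v} f" if "0 \<le> u" "u \<le> v" "v \<le> \<delta>" for u v
    unfolding U_def by (rule integral_split[OF int that])
  have U_deriv: "(U has_real_derivative f x) (at x)" if "x \<in> {0<..<\<delta>}" for x
    unfolding U_def by (rule indefinite_integral_deriv[OF int cont that])
  define V where "V = (\<lambda>x. U (y x) - U x)"
  have y_range: "y x \<in> {0<..<\<delta>}" if "x \<in> {0<..<\<delta>}" for x
    using y_bounds[OF that] that by auto
  have V_mono: "V u \<le> V v" if "0 < u" "u \<le> v" "v < \<delta>" for u v
  proof (rule DERIV_nonneg_imp_nondecreasing[OF that(2)])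
    fix x assume "u \<le> x" "x \<le> v"
    then have x: "x \<in> {0<..<\<delta>}" using that by auto
    have "(V has_real_derivative (f (y x) * y' x - f x)) (at x)"
      unfolding V_def
      by (intro DERIV_diff U_deriv x DERIV_chain2[where f=U and g=y] y_range y_deriv)
    then show "\<exists>l. (V has_real_derivative l) (at x) \<and> 0 \<le> l"
      using sub[OF x] by fastforce
  qed
  have U0: "(U \<longlongrightarrow> 0) (at_right 0)"
  proof -
    have "(U \<longlongrightarrow> U 0) (at 0 within {0..\<delta>})"
      using U_cont z by (auto simp: continuous_on_def)
    moreover have "at 0 within {0..\<delta>} = at_right (0::real)"
      by (rule at_within_Icc_at_right) (use z in auto)
    ultimately show ?thesis by (simp add: U_def)
  qed
  have ev: "\<forall>\<^sub>F x in at_right 0. x \<in> {0<..<z}"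
    by (rule eventually_at_right_real) (use z in auto)
  have ev_y: "\<forall>\<^sub>F x in at_right 0. x \<in> {0<..<\<delta>}"
    using ev by eventually_elim (use z in auto)
  have y0: "filterlim y (at_right 0) (at_right 0)"
  proof (rule tendsto_imp_filterlim_at_right)
    show "(y \<longlongrightarrow> 0) (at_right 0)"
    proof (rule tendsto_sandwich[where f="\<lambda>_. 0" and h="\<lambda>x. x"])
      show "\<forall>\<^sub>F x in at_right 0. 0 \<le> y x" "\<forall>\<^sub>F x in at_right 0. y x \<le> x"
        using ev_y by (eventually_elim, use y_bounds in force)+
    qed (auto intro: tendsto_eq_intros)
    show "\<forall>\<^sub>F x in at_right 0. 0 < y x"
      using ev_y by eventually_elim (use y_bounds in force)
  qed
  have "(V \<longlongrightarrow> 0 - 0) (at_right 0)"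
    unfolding V_def by (intro tendsto_diff U0 filterlim_compose[OF U0 y0])
  moreover have "\<forall>\<^sub>F x in at_right 0. V x \<le> V z"
    using ev by eventually_elim (use V_mono z in auto)
  ultimately have "0 - 0 \<le> V z"
    by (rule tendsto_upperbound) simp
  then have "integral {y z..z} f \<le> 0"
    using U_diff[of "y z" z] y_bounds[OF z] z unfolding V_def by simp
  moreover have "integral {y z..z} f \<ge> 0"
    using y_bounds[OF z] z
    by (intro integral_nonneg integrable_on_subinterval[OF int] nonneg) auto
  ultimately have "integral {y z..z} f = 0" by simp
  moreover have "(integral {y z..z} f = 0) = (\<forall>x\<in>{y z..z}. f x = 0)"
    by (rule integral_eq_0_iff)
       (use y_bounds[OF z] z nonneg in \<open>auto intro: continuous_on_subset[OF cont]\<close>)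
  ultimately show ?thesis using y_bounds[OF z] by auto
qed

section \<open>Limits of powers and asymptotic ratios\<close>

lemma tendsto_of_smallo:
  fixes f g k :: "'a \<Rightarrow> real"
  assumes "(\<lambda>x. f x - k x) \<in> o[F](g)" "(g \<longlongrightarrow> 0) F" "(k \<longlongrightarrow> L) F"
  shows "(f \<longlongrightarrow> L) F"
proof -
  have "\<forall>\<^sub>F x in F. norm (f x - k x) \<le> norm (g x) * 1"
    using landau_o.smallD[OF assms(1), of 1] by simp
  with assms(2) have "((\<lambda>x. f x - k x) \<longlongrightarrow> 0) F" by (rule tendsto_0_le)
  from tendsto_add[OF this assms(3)] show ?thesis by simp
qed

lemma powr_tendsto_0_right: "0 < r \<Longrightarrow> ((\<lambda>x::real. (x - c) powr r) \<longlongrightarrow> 0) (at_right c)"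
  by (rule tendsto_zero_powrI[where b = r]) (auto intro!: tendsto_eq_intros simp: eventually_at_filter)

lemma powr_tendsto_0_left: "0 < r \<Longrightarrow> ((\<lambda>x::real. (c - x) powr r) \<longlongrightarrow> 0) (at_left c)"
  by (rule tendsto_zero_powrI[where b = r]) (auto intro!: tendsto_eq_intros simp: eventually_at_filter)

lemma powr_scale_tendsto_left:
  fixes s c :: real
  assumes "0 \<le> s"
  shows "((\<lambda>x. (c - x) powr s) \<longlongrightarrow> (if s = 0 then 1 else 0)) (at_left c)"
proof (cases "s = 0")
  case True
  have "\<forall>\<^sub>F x in at_left c. x \<in> {c - 1<..<c}" by (rule eventually_at_left_real) simp
  then have "\<forall>\<^sub>F x in at_left c. (c - x) powr s = 1" by eventually_elim (use True in auto)
  with True show ?thesis by (simp add: tendsto_eventually)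
next
  case False
  then show ?thesis using powr_tendsto_0_left[of s c] assms by simp
qed

lemma tendsto_ratio_of_smallo:
  fixes f g :: "'a \<Rightarrow> real"
  assumes o: "(\<lambda>x. f x - k * g x) \<in> o[F](g)" and ev: "\<forall>\<^sub>F x in F. g x \<noteq> 0"
  shows "((\<lambda>x. f x / g x) \<longlongrightarrow> k) F"
proof (rule Lim_transform_eventually)
  show "((\<lambda>x. k + (f x - k * g x) / g x) \<longlongrightarrow> k) F"
    using tendsto_add[OF tendsto_const smalloD_tendsto[OF o], of k] by simp
  show "\<forall>\<^sub>F x in F. k + (f x - k * g x) / g x = f x / g x"
    using ev by eventually_elim (simp add: field_simps)
qed

lemma smallo_of_tendsto_ratio:
  fixes f g :: "'a \<Rightarrow> real"
  assumes lim: "((\<lambda>x. f x / g x) \<longlongrightarrow> k) F" and ev: "\<forall>\<^sub>F x in F. g x \<noteq> 0"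
  shows "(\<lambda>x. f x - k * g x) \<in> o[F](g)"
proof (rule smalloI_tendsto[OF _ ev])
  from tendsto_diff[OF lim tendsto_const, of k]
  have "((\<lambda>x. f x / g x - k) \<longlongrightarrow> 0) F" by simp
  then show "((\<lambda>x. (f x - k * g x) / g x) \<longlongrightarrow> 0) F"
    by (rule Lim_transform_eventually) (use ev in eventually_elim, simp add: diff_divide_distrib)
qed

section \<open>The branches of the map and their inverses\<close>

context cusp_map
begin

lemma x0_bounds: "0 < x\<^sub>0" "x\<^sub>0 < 1"
  using x0 by auto

lemma T_in_unit: "x \<in> {0..1} \<Longrightarrow> T x \<in> {0..1}"
  using left_onto right_onto by (cases "x \<le> x\<^sub>0") auto

lemma T_x0: "T x\<^sub>0 = 1"
proof -
  obtain y where "y \<in> {0..x\<^sub>0}" "T y = 1"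
    using left_onto by (metis imageE atLeastAtMost_iff order_refl zero_le_one)
  then have "1 \<le> T x\<^sub>0" using mono_onD[OF left_mono, of y x\<^sub>0] by auto
  then show ?thesis using T_in_unit[of x\<^sub>0] x0 by auto
qed

lemma T_0: "T 0 = 0"
proof -
  obtain y where "y \<in> {0..x\<^sub>0}" "T y = 0"
    using left_onto by (metis imageE atLeastAtMost_iff order_refl zero_le_one)
  then have "T 0 \<le> 0" using mono_onD[OF left_mono, of 0 y] by auto
  then show ?thesis using T_in_unit[of 0] by auto
qed

lemma T_1: "T 1 = 0"
proof -
  obtain y where "y \<in> {x\<^sub>0..1}" "T y = 0"
    using right_onto by (metis imageE atLeastAtMost_iff order_refl zero_le_one)
  then have "T 1 \<le> 0" using monotone_onD[OF right_antimono, of y 1] by auto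
  then show ?thesis using T_in_unit[of 1] by auto
qed

lemma deriv_interior: "x \<in> {0<..<1} - {x\<^sub>0} \<Longrightarrow> (T has_real_derivative DT x) (at x)"
  using deriv[of x] at_within_Icc_at[of 0 x 1] by simp

text \<open>Continuity of \<open>T\<close> at the cusp, from either side, is read off from the expansions there.\<close>

lemma T_tendsto_left: "(T \<longlongrightarrow> 1) (at_left x\<^sub>0)"
proof -
  have g: "((\<lambda>x. (x\<^sub>0 - x) powr B') \<longlongrightarrow> 0) (at_left x\<^sub>0)"
    using powr_tendsto_0_left params_left by blast
  show ?thesis
    using tendsto_of_smallo[OF T_left g tendsto_diff[OF tendsto_const tendsto_mult_left[OF g]]]
    by simp
qed

lemma T_tendsto_right: "(T \<longlongrightarrow> 1) (at_right x\<^sub>0)"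
proof -
  have g: "((\<lambda>x. (x - x\<^sub>0) powr B) \<longlongrightarrow> 0) (at_right x\<^sub>0)"
    using powr_tendsto_0_right params_right by blast
  show ?thesis
    using tendsto_of_smallo[OF T_right g tendsto_diff[OF tendsto_const tendsto_mult_left[OF g]]]
    by simp
qed

lemma T_continuous: "continuous_on {0..1} T"
  unfolding continuous_on_eq_continuous_within
proof
  fix x :: real assume x: "x \<in> {0..1}"
  show "continuous (at x within {0..1}) T"
  proof (cases "x = x\<^sub>0")
    case True
    have "(T \<longlongrightarrow> T x\<^sub>0) (at x\<^sub>0)"
      using T_tendsto_left T_tendsto_right by (simp add: filterlim_split_at T_x0)
    then show ?thesis
      using True by (auto simp: continuous_within intro: tendsto_within_subset)
  next
    case False
    then show ?thesis using deriv[of x] x by (auto intro: DERIV_continuous)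
  qed
qed

lemma T_MVT:
  assumes "0 \<le> u" "u < v" "v \<le> 1" "v \<le> x\<^sub>0 \<or> x\<^sub>0 \<le> u"
  obtains z where "u < z" "z < v" "T v - T u = (v - u) * DT z"
proof -
  have d: "(T has_real_derivative DT x) (at x)" if "u < x" "x < v" for x
    using that assms by (intro deriv_interior) auto
  have "\<exists>l z. u < z \<and> z < v \<and> DERIV T z :> l \<and> T v - T u = (v - u) * l"
  proof (rule MVT[OF assms(2)])
    show "continuous_on {u..v} T"
      by (rule continuous_on_subset[OF T_continuous]) (use assms in auto)
    show "T differentiable (at x)" if "u < x" "x < v" for x
      unfolding real_differentiable_def using d[OF that] by blast
  qed
  then obtain l z where z: "u < z" "z < v" "DERIV T z :> l" "T v - T u = (v - u) * l" by blast
  have "l = DT z" by (rule DERIV_unique[OF z(3) d[OF z(1,2)]])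
  then show ?thesis using that z by blast
qed

text \<open>Monotonicity of \<open>DT\<close> comes from adding the tangent line inequalities of a convex function at two
  points. Together with the limits of \<open>DT\<close> at \<open>0\<close> and \<open>1\<close> it yields the sharp lower bounds
  \<open>DT \<ge> \<alpha>'\<close> and \<open>\<bar>DT\<bar> \<ge> \<alpha>\<close> on the open branches.\<close>

lemma DT_mono_branch:
  assumes conv: "convex_on {p..q} T" and sub: "{p<..<q} \<subseteq> {0<..<1} - {x\<^sub>0}"
    and "p < x" "x \<le> y" "y < q"
  shows "DT x \<le> DT y"
proof (cases "x = y")
  case False
  have tangent: "DT u * (v - u) \<le> T v - T u" if "u \<in> {p<..<q}" "v \<in> {p..q}" for u v
  proof (rule convex_on_imp_above_tangent[OF conv])
    show "(T has_real_derivative DT u) (at u within {p..q})"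
      by (rule has_field_derivative_at_within[OF deriv_interior]) (use that sub in blast)
    show "u \<in> interior {p..q}" using that(1) by simp
  qed (use that in simp_all)
  have "DT x * (y - x) \<le> T y - T x" "DT y * (x - y) \<le> T x - T y"
    using assms(3-5) by (intro tangent; simp)+
  then have "DT x * (y - x) \<le> DT y * (y - x)" by (simp add: algebra_simps)
  then show ?thesis using \<open>x \<le> y\<close> False by simp
qed simp

lemma DT_left_mono: "\<lbrakk>0 < x; x \<le> y; y < x\<^sub>0\<rbrakk> \<Longrightarrow> DT x \<le> DT y"
  by (rule DT_mono_branch[OF left_convex]) (use x0_bounds in auto)

lemma DT_right_mono: "\<lbrakk>x\<^sub>0 < x; x \<le> y; y < 1\<rbrakk> \<Longrightarrow> DT x \<le> DT y"
  by (rule DT_mono_branch[OF right_convex]) (use x0_bounds in auto)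

lemma DT_tendsto_0: "(DT \<longlongrightarrow> \<alpha>') (at_right 0)"
proof -
  obtain c where c: "(\<lambda>x. DT x - (\<alpha>' + c * x powr \<psi>)) \<in> o[at_right 0](\<lambda>x. x powr \<psi>)"
    using DT_at_0 by blast
  have g: "((\<lambda>x::real. x powr \<psi>) \<longlongrightarrow> 0) (at_right 0)"
    using powr_tendsto_0_right[of \<psi> 0] params_0 by simp
  show ?thesis
    using tendsto_of_smallo[OF c g tendsto_add[OF tendsto_const tendsto_mult_left[OF g]]] by simp
qed

lemma DT_tendsto_1: "(DT \<longlongrightarrow> - \<alpha>) (at_left 1)"
proof -
  obtain c where c: "(\<lambda>x. DT x - (- \<alpha> - c * (1 - x) powr \<kappa>)) \<in> o[at_left 1](\<lambda>x. (1 - x) powr \<kappa>)"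
    using DT_at_1 by blast
  have g: "((\<lambda>x::real. (1 - x) powr \<kappa>) \<longlongrightarrow> 0) (at_left 1)"
    using powr_tendsto_0_left[of \<kappa> 1] params_1 by simp
  show ?thesis
    using tendsto_of_smallo[OF c g tendsto_diff[OF tendsto_const tendsto_mult_left[OF g]]] by simp
qed

lemma DT_left_ge: "x \<in> {0<..<x\<^sub>0} \<Longrightarrow> \<alpha>' \<le> DT x"
proof (rule tendsto_upperbound[OF DT_tendsto_0])
  assume x: "x \<in> {0<..<x\<^sub>0}"
  have "\<forall>\<^sub>F t in at_right 0. t \<in> {0<..<x}" by (rule eventually_at_right_real) (use x in auto)
  then show "\<forall>\<^sub>F t in at_right 0. DT t \<le> DT x"
    by eventually_elim (use x DT_left_mono in auto)
qed simp

lemma DT_right_le: "x \<in> {x\<^sub>0<..<1} \<Longrightarrow> DT x \<le> - \<alpha>"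
proof (rule tendsto_lowerbound[OF DT_tendsto_1])
  assume x: "x \<in> {x\<^sub>0<..<1}"
  have "\<forall>\<^sub>F t in at_left 1. t \<in> {x<..<1}" by (rule eventually_at_left_real) (use x in auto)
  then show "\<forall>\<^sub>F t in at_left 1. DT x \<le> DT t"
    by eventually_elim (use x DT_right_mono in auto)
qed simp

lemma T_left_less: "\<lbrakk>0 \<le> u; u < v; v \<le> x\<^sub>0\<rbrakk> \<Longrightarrow> T u < T v"
proof -
  assume a: "0 \<le> u" "u < v" "v \<le> x\<^sub>0"
  obtain z where "u < z" "z < v" "T v - T u = (v - u) * DT z"
    by (rule T_MVT[of u v]) (use a x0_bounds in auto)
  moreover have "0 < DT z" using DT_left_ge[of z] params_0 calculation a by auto
  ultimately show ?thesis using a mult_pos_pos[of "v - u" "DT z"] by linarith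
qed

lemma T_right_less: "\<lbrakk>x\<^sub>0 \<le> u; u < v; v \<le> 1\<rbrakk> \<Longrightarrow> T v < T u"
proof -
  assume a: "x\<^sub>0 \<le> u" "u < v" "v \<le> 1"
  obtain z where "u < z" "z < v" "T v - T u = (v - u) * DT z"
    by (rule T_MVT[of u v]) (use a x0_bounds in auto)
  moreover have "DT z < 0" using DT_right_le[of z] params_1 calculation a by auto
  ultimately show ?thesis using a mult_pos_neg[of "v - u" "DT z"] by linarith
qed

lemma inj_left: "inj_on T {0..x\<^sub>0}"
  by (rule inj_onI) (metis T_left_less atLeastAtMost_iff less_irrefl neqE)

lemma inj_right: "inj_on T {x\<^sub>0..1}"
  by (rule inj_onI) (metis T_right_less atLeastAtMost_iff less_irrefl neqE)

lemma left_inv_T: "x \<in> {0..x\<^sub>0} \<Longrightarrow> left_inv (T x) = x"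
  unfolding left_inv_def by (rule the_inv_into_f_f[OF inj_left])

lemma right_inv_T: "x \<in> {x\<^sub>0..1} \<Longrightarrow> right_inv (T x) = x"
  unfolding right_inv_def by (rule the_inv_into_f_f[OF inj_right])

lemma T_left_inv: "x \<in> {0..1} \<Longrightarrow> T (left_inv x) = x"
  unfolding left_inv_def by (rule f_the_inv_into_f[OF inj_left]) (use left_onto in auto)

lemma T_right_inv: "x \<in> {0..1} \<Longrightarrow> T (right_inv x) = x"
  unfolding right_inv_def by (rule f_the_inv_into_f[OF inj_right]) (use right_onto in auto)

lemma left_inv_in: "x \<in> {0..1} \<Longrightarrow> left_inv x \<in> {0..x\<^sub>0}"
  unfolding left_inv_def by (rule the_inv_into_into[OF inj_left]) (use left_onto in auto)

lemma right_inv_in: "x \<in> {0..1} \<Longrightarrow> right_inv x \<in> {x\<^sub>0..1}"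
  unfolding right_inv_def by (rule the_inv_into_into[OF inj_right]) (use right_onto in auto)

lemma left_inv_open:
  assumes x: "x \<in> {0<..<1}"
  shows "left_inv x \<in> {0<..<x\<^sub>0}"
proof -
  have "left_inv x \<in> {0..x\<^sub>0}" "T (left_inv x) = x"
    using left_inv_in T_left_inv x by auto
  moreover from this x have "left_inv x \<noteq> 0" "left_inv x \<noteq> x\<^sub>0"
    using T_0 T_x0 by auto
  ultimately show ?thesis by simp
qed

lemma right_inv_open:
  assumes x: "x \<in> {0<..<1}"
  shows "right_inv x \<in> {x\<^sub>0<..<1}"
proof -
  have "right_inv x \<in> {x\<^sub>0..1}" "T (right_inv x) = x"
    using right_inv_in T_right_inv x by auto
  moreover from this x have "right_inv x \<noteq> 1" "right_inv x \<noteq> x\<^sub>0"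
    using T_1 T_x0 by auto
  ultimately show ?thesis by simp
qed

lemma left_inv_continuous: "continuous_on {0..1} left_inv"
proof -
  have "continuous_on {0..x\<^sub>0} T"
    by (rule continuous_on_subset[OF T_continuous]) (use x0_bounds in auto)
  then have "continuous_on (T ` {0..x\<^sub>0}) left_inv"
    by (rule continuous_on_inv) (simp_all add: left_inv_T)
  then show ?thesis unfolding left_onto .
qed

lemma right_inv_continuous: "continuous_on {0..1} right_inv"
proof -
  have "continuous_on {x\<^sub>0..1} T"
    by (rule continuous_on_subset[OF T_continuous]) (use x0_bounds in auto)
  then have "continuous_on (T ` {x\<^sub>0..1}) right_inv"
    by (rule continuous_on_inv) (simp_all add: right_inv_T)
  then show ?thesis unfolding right_onto .
qed

lemma left_inv_deriv:
  assumes x: "x \<in> {0<..<1}"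
  shows "(left_inv has_real_derivative inverse (DT (left_inv x))) (at x)"
proof (rule DERIV_inverse_function[where f = T and a = 0 and b = 1])
  have l: "left_inv x \<in> {0<..<x\<^sub>0}" by (rule left_inv_open[OF x])
  show "(T has_real_derivative DT (left_inv x)) (at (left_inv x))"
    by (rule deriv_interior) (use l x0_bounds in auto)
  show "DT (left_inv x) \<noteq> 0" using DT_left_ge[OF l] params_0 by auto
  show "isCont left_inv x"
    using left_inv_continuous x by (intro continuous_on_interior[of "{0..1}"]) auto
qed (use x T_left_inv in auto)

lemma right_inv_deriv:
  assumes x: "x \<in> {0<..<1}"
  shows "(right_inv has_real_derivative inverse (DT (right_inv x))) (at x)"
proof (rule DERIV_inverse_function[where f = T and a = 0 and b = 1])
  have l: "right_inv x \<in> {x\<^sub>0<..<1}" by (rule right_inv_open[OF x])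
  show "(T has_real_derivative DT (right_inv x)) (at (right_inv x))"
    by (rule deriv_interior) (use l x0_bounds in auto)
  show "DT (right_inv x) \<noteq> 0" using DT_right_le[OF l] params_1 by auto
  show "isCont right_inv x"
    using right_inv_continuous x by (intro continuous_on_interior[of "{0..1}"]) auto
qed (use x T_right_inv in auto)

lemma T_ge_linear: "x \<in> {0<..<x\<^sub>0} \<Longrightarrow> \<alpha>' * x \<le> T x"
proof -
  assume x: "x \<in> {0<..<x\<^sub>0}"
  obtain z where "0 < z" "z < x" "T x - T 0 = (x - 0) * DT z"
    by (rule T_MVT[of 0 x]) (use x x0_bounds in auto)
  moreover have "\<alpha>' \<le> DT z" using DT_left_ge[of z] calculation x by auto
  ultimately show ?thesis using x T_0 by (simp add: mult.commute)
qed

lemma left_inv_bounds: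
  assumes x: "x \<in> {0<..<1}"
  shows "0 < left_inv x \<and> left_inv x < x"
proof -
  have l: "left_inv x \<in> {0<..<x\<^sub>0}" by (rule left_inv_open[OF x])
  then have "1 * left_inv x < \<alpha>' * left_inv x"
    using params_0 by (intro mult_strict_right_mono) auto
  also have "\<dots> \<le> x" using T_ge_linear[OF l] T_left_inv[of x] x by simp
  finally show ?thesis using l by simp
qed

end

section \<open>The preimages of the cusp and expansion of the return map\<close>

context cusp_map
begin

lemma a'_0: "a' 0 = left_inv x\<^sub>0"
  by (simp add: a'_def)

lemma a'_Suc: "a' (Suc p) = left_inv (a' p)"
  by (simp add: a'_def)

lemma a_Suc: "a (Suc p) = right_inv (a' p)"
  by (simp add: a_def a'_def)

lemma a_0: "a 0 = right_inv x\<^sub>0"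
  by (simp add: a_def)

lemma a'_in: "a' p \<in> {0<..<x\<^sub>0}"
proof (induction p)
  case 0
  then show ?case using left_inv_open[OF x0] by (simp add: a'_0)
next
  case (Suc p)
  then have "a' p \<in> {0<..<1}" using x0_bounds by auto
  from left_inv_open[OF this] show ?case by (simp add: a'_Suc)
qed

lemma a'_in_unit: "a' p \<in> {0<..<1}"
  using a'_in[of p] x0_bounds by auto

lemma a_in: "a p \<in> {x\<^sub>0<..<1}"
  using right_inv_open[OF x0] right_inv_open[OF a'_in_unit] by (cases p) (simp_all add: a_0 a_Suc)

lemma T_a'_0: "T (a' 0) = x\<^sub>0"
  using T_left_inv[of x\<^sub>0] x0_bounds by (simp add: a'_0)

lemma T_a'_Suc: "T (a' (Suc p)) = a' p"
  using T_left_inv[of "a' p"] a'_in_unit[of p] by (simp add: a'_Suc)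

lemma T_a_0: "T (a 0) = x\<^sub>0"
  using T_right_inv[of x\<^sub>0] x0_bounds by (simp add: a_0)

lemma T_a_Suc: "T (a (Suc p)) = a' p"
  using T_right_inv[of "a' p"] a'_in_unit[of p] by (simp add: a_Suc)

lemma a'_tendsto_0: "a' \<longlonglongrightarrow> 0"
proof (rule tendsto_sandwich[where f="\<lambda>_. 0" and h="\<lambda>p. x\<^sub>0 * (1 / \<alpha>') ^ p"])
  have "a' p \<le> x\<^sub>0 * (1 / \<alpha>') ^ p" for p
  proof (induction p)
    case 0
    then show ?case using a'_in[of 0] by simp
  next
    case (Suc p)
    have "\<alpha>' * a' (Suc p) \<le> a' p" using T_ge_linear[OF a'_in[of "Suc p"]] by (simp add: T_a'_Suc)
    with Suc have "\<alpha>' * a' (Suc p) \<le> x\<^sub>0 * (1 / \<alpha>') ^ p" by simp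
    then show ?case using params_0 by (simp add: field_simps)
  qed
  then show "\<forall>\<^sub>F p in sequentially. a' p \<le> x\<^sub>0 * (1 / \<alpha>') ^ p" by simp
  show "\<forall>\<^sub>F p in sequentially. 0 \<le> a' p" using a'_in by (simp add: less_imp_le)
  have "(\<lambda>p. (1 / \<alpha>') ^ p) \<longlonglongrightarrow> 0" using params_0 by (intro LIMSEQ_realpow_zero) auto
  from tendsto_mult_left[OF this, of x\<^sub>0] show "(\<lambda>p. x\<^sub>0 * (1 / \<alpha>') ^ p) \<longlonglongrightarrow> 0" by simp
qed simp

lemma b1_properties: "x\<^sub>0 < b\<^sub>1" "b\<^sub>1 < a 0" "T b\<^sub>1 = a 0"
proof -
  let ?P = "\<lambda>b. b \<in> {x\<^sub>0<..<a 0} \<and> T b = a 0"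
  have a0: "x\<^sub>0 < a 0" "a 0 < 1" using a_in[of 0] by auto
  have "\<exists>b. x\<^sub>0 \<le> b \<and> b \<le> a 0 \<and> T b = a 0"
    by (rule IVT2') (use a0 x0_bounds in \<open>auto simp: T_a_0 T_x0 intro: continuous_on_subset[OF T_continuous]\<close>)
  then obtain b where b: "x\<^sub>0 \<le> b" "b \<le> a 0" "T b = a 0" by blast
  have "b \<noteq> x\<^sub>0" "b \<noteq> a 0" using b(3) T_x0 T_a_0 a0 by auto
  with b have Pb: "?P b" by auto
  have "c = b" if "?P c" for c
    by (rule inj_onD[OF inj_right]) (use that Pb a0 in auto)
  from theI[of ?P, OF Pb this] have "?P b\<^sub>1" unfolding b\<^sub>1_def by blast
  then show "x\<^sub>0 < b\<^sub>1" "b\<^sub>1 < a 0" "T b\<^sub>1 = a 0" by auto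
qed

end

text \<open>A set \<open>Z\<close> that contains \<open>x\<^sub>0\<close> and, with each of its points, all preimages in \<open>(0, 1)\<close> other
  than \<open>x\<^sub>0\<close>. It is applied to the zero set of the density.\<close>

locale backward_invariant = lorenz_cusp_map +
  fixes Z :: "real set"
  assumes x0_Z: "x\<^sub>0 \<in> Z"
    and preimage_Z: "\<And>x. \<lbrakk>x \<in> {0<..<1} - {x\<^sub>0}; T x \<in> Z\<rbrakk> \<Longrightarrow> x \<in> Z"
begin

lemma a'_Z: "a' p \<in> Z"
proof (induction p)
  case 0
  show ?case by (rule preimage_Z) (use a'_in[of 0] x0_bounds x0_Z in \<open>auto simp: T_a'_0\<close>)
next
  case (Suc p)
  show ?case by (rule preimage_Z) (use Suc a'_in[of "Suc p"] x0_bounds in \<open>auto simp: T_a'_Suc\<close>)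
qed

lemma a_Z: "a p \<in> Z"
proof (rule preimage_Z)
  show "a p \<in> {0<..<1} - {x\<^sub>0}" using a_in[of p] x0_bounds by auto
  show "T (a p) \<in> Z" using x0_Z a'_Z by (cases p) (auto simp: T_a_0 T_a_Suc)
qed

lemma b1_Z: "b\<^sub>1 \<in> Z"
  by (rule preimage_Z) (use b1_properties a_Z[of 0] a_in[of 0] x0_bounds in auto)

text \<open>A gap is a nonempty open subinterval of \<open>[0, 1]\<close>, given by its endpoints, that is disjoint from
  \<open>Z\<close>. A gap never contains \<open>x\<^sub>0\<close>, so \<open>T\<close> maps it monotonically onto an interval, which is again a
  gap.\<close>

definition gap :: "real \<Rightarrow> real \<Rightarrow> bool" where
  "gap u v \<longleftrightarrow> 0 \<le> u \<and> u < v \<and> v \<le> 1 \<and> {u<..<v} \<inter> Z = {}"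

lemma gap_avoids:
  assumes "gap u v" "z \<in> Z"
  shows "v \<le> z \<or> z \<le> u"
proof (rule ccontr)
  assume "\<not> ?thesis"
  then have "z \<in> {u<..<v} \<inter> Z" using assms(2) by simp
  then show False using assms(1) unfolding gap_def by blast
qed

lemma gap_image_left:
  assumes g: "gap u v" and v: "v \<le> x\<^sub>0"
  shows "gap (T u) (T v)"
proof -
  have uv: "0 \<le> u" "u < v" "{u<..<v} \<inter> Z = {}" using g by (auto simp: gap_def)
  have "T u < T v" using T_left_less uv v by auto
  moreover have "T u \<in> {0..1}" "T v \<in> {0..1}" using uv v x0_bounds by (intro T_in_unit; simp)+
  moreover have "y \<notin> Z" if y: "T u < y" "y < T v" for y
  proof
    assume "y \<in> Z"
    have "\<exists>x. u \<le> x \<and> x \<le> v \<and> T x = y"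
      by (rule IVT') (use y uv v x0_bounds in \<open>auto intro: continuous_on_subset[OF T_continuous]\<close>)
    then obtain x where x: "u \<le> x" "x \<le> v" "T x = y" by blast
    with y have "u \<noteq> x" "x \<noteq> v" by auto
    with x uv v x0_bounds have "x \<in> {u<..<v}" "x \<in> {0<..<1} - {x\<^sub>0}" by auto
    with preimage_Z[of x] x \<open>y \<in> Z\<close> uv(3) show False by auto
  qed
  ultimately show ?thesis unfolding gap_def by auto
qed

lemma gap_image_right:
  assumes g: "gap u v" and u: "x\<^sub>0 \<le> u"
  shows "gap (T v) (T u)"
proof -
  have uv: "v \<le> 1" "u < v" "{u<..<v} \<inter> Z = {}" using g by (auto simp: gap_def)
  have "T v < T u" using T_right_less uv u by auto
  moreover have "T u \<in> {0..1}" "T v \<in> {0..1}" using uv u x0_bounds by (intro T_in_unit; simp)+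
  moreover have "y \<notin> Z" if y: "T v < y" "y < T u" for y
  proof
    assume "y \<in> Z"
    have "\<exists>x. u \<le> x \<and> x \<le> v \<and> T x = y"
      by (rule IVT2') (use y uv u x0_bounds in \<open>auto intro: continuous_on_subset[OF T_continuous]\<close>)
    then obtain x where x: "u \<le> x" "x \<le> v" "T x = y" by blast
    with y have "u \<noteq> x" "x \<noteq> v" by auto
    with x uv u x0_bounds have "x \<in> {u<..<v}" "x \<in> {0<..<1} - {x\<^sub>0}" by auto
    with preimage_Z[of x] x \<open>y \<in> Z\<close> uv(3) show False by auto
  qed
  ultimately show ?thesis unfolding gap_def by auto
qed

lemma left_stretch:
  assumes "0 < w" "w \<le> u" "u < v" "v \<le> x\<^sub>0"
  shows "DT w * (v - u) \<le> T v - T u"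
proof -
  obtain z where z: "u < z" "z < v" "T v - T u = (v - u) * DT z"
    by (rule T_MVT[of u v]) (use assms x0_bounds in auto)
  have "DT w \<le> DT z" using z assms by (intro DT_left_mono) auto
  then have "DT w * (v - u) \<le> DT z * (v - u)" using assms by (intro mult_right_mono) auto
  then show ?thesis using z(3) by (simp add: mult.commute)
qed

lemma right_stretch:
  assumes "x\<^sub>0 \<le> u" "u < v" "v \<le> w" "w < 1"
  shows "\<bar>DT w\<bar> * (v - u) \<le> T u - T v"
proof -
  obtain z where z: "u < z" "z < v" "T v - T u = (v - u) * DT z"
    by (rule T_MVT[of u v]) (use assms x0_bounds in auto)
  have "DT z \<le> DT w" using z assms by (intro DT_right_mono) auto
  moreover have "DT w < 0" using DT_right_le[of w] params_1 z assms by auto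
  ultimately have "\<bar>DT w\<bar> * (v - u) \<le> - DT z * (v - u)" using assms by (intro mult_right_mono) auto
  then show ?thesis using z(3) by (simp add: mult.commute)
qed

text \<open>The left branch is cut by the points \<open>a' k\<close> into the cells \<open>[a' k, T (a' k)]\<close>; here \<open>T (a' k)\<close> is
  \<open>x\<^sub>0\<close> for \<open>k = 0\<close> and \<open>a' (k - 1)\<close> otherwise.\<close>

lemma gap_cell:
  assumes g: "gap u v" and v: "v \<le> x\<^sub>0"
  obtains k where "a' k \<le> u" "v \<le> T (a' k)"
proof -
  have "0 < v" using g by (auto simp: gap_def)
  then have "\<forall>\<^sub>F k in sequentially. a' k < v" using a'_tendsto_0 by (rule order_tendstoD(2)[rotated])
  then have ex: "\<exists>k. a' k < v" by (auto simp: eventually_sequentially)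
  \<comment> \<open>the cell is found from the largest cut point to the left of \<open>v\<close>\<close>
  define k where "k = (LEAST k. a' k < v)"
  have "a' k < v" unfolding k_def by (rule LeastI_ex[OF ex])
  then have "a' k \<le> u" using gap_avoids[OF g a'_Z[of k]] by auto
  moreover have "v \<le> T (a' k)"
  proof (cases k)
    case 0
    then show ?thesis using v by (simp add: T_a'_0)
  next
    case (Suc j)
    then have "\<not> a' j < v" using not_less_Least[of j "\<lambda>k. a' k < v"] by (simp add: k_def)
    then show ?thesis using Suc by (simp add: T_a'_Suc)
  qed
  ultimately show ?thesis by (rule that)
qed

text \<open>A gap in the \<open>k\<close>-th cell reaches \<open>[a' 0, x\<^sub>0]\<close> after \<open>k\<close> steps of the left branch. On the \<open>j\<close>-th cell
  the derivative is smallest at the left endpoint \<open>a' j\<close>.\<close>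

lemma gap_climb:
  assumes "gap u v" "a' k \<le> u" "v \<le> T (a' k)"
  shows "\<exists>u' v'. gap u' v' \<and> a' 0 \<le> u' \<and> v' \<le> x\<^sub>0 \<and> (\<Prod>j = 1..k. DT (a' j)) * (v - u) \<le> v' - u'"
  using assms
proof (induction k arbitrary: u v)
  case 0
  then show ?case by (intro exI[of _ u] exI[of _ v]) (auto simp: T_a'_0)
next
  case (Suc k)
  have uv: "u < v" and v: "v \<le> x\<^sub>0"
    using Suc.prems a'_in[of k] by (auto simp: gap_def T_a'_Suc)
  have "T (a' (Suc k)) \<le> T u"
    using T_left_less[of "a' (Suc k)" u] a'_in[of "Suc k"] Suc.prems uv v
    by (cases "a' (Suc k) = u") auto
  moreover have "T v \<le> T (a' k)"
    using T_left_less[of v "a' k"] a'_in[of k] Suc.prems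
    by (cases "v = a' k") (auto simp: T_a'_Suc gap_def)
  ultimately obtain u' v' where IH: "gap u' v'" "a' 0 \<le> u'" "v' \<le> x\<^sub>0"
      "(\<Prod>j = 1..k. DT (a' j)) * (T v - T u) \<le> v' - u'"
    using Suc.IH[OF gap_image_left[OF Suc.prems(1) v]] by (auto simp: T_a'_Suc)
  have pos: "0 \<le> (\<Prod>j = 1..k. DT (a' j))"
    using DT_left_ge[OF a'_in] params_0 by (intro prod_nonneg) (auto intro: order_trans[of 0 \<alpha>'])
  have "DT (a' (Suc k)) * (v - u) \<le> T v - T u"
    using a'_in[of "Suc k"] Suc.prems uv v by (intro left_stretch) auto
  from mult_left_mono[OF this pos] IH(4)
  have "(\<Prod>j = 1..Suc k. DT (a' j)) * (v - u) \<le> v' - u'" by (simp add: mult.assoc)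
  with IH show ?case by blast
qed

text \<open>For \<open>p = k + 2\<close> up to \<open>p\<^sup>*\<close> the bound is the return expansion condition; for larger \<open>p\<close> it follows
  from \<open>\<bar>DT\<bar> \<ge> \<alpha>\<close> on the right branch and \<open>DT \<ge> \<alpha>'\<close> on the left one, as \<open>p\<^sup>*\<close> is chosen such that
  \<open>\<alpha> * \<alpha>' ^ (p - 1)\<close> exceeds the required constant.\<close>

lemma return_factor:
  obtains \<sigma> where "1 < \<sigma>" "\<sigma> \<le> d_10" "\<sigma> \<le> \<alpha>'"
    "\<And>k. \<sigma> \<le> \<bar>DT (a (Suc k))\<bar> * (\<Prod>j = 0..k. DT (a' j))"
proof -
  obtain \<sigma> where \<sigma>: "1 < \<sigma>" "\<sigma> \<le> min d_10 \<alpha>'"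
    and early: "\<And>p. 1 < p \<Longrightarrow> int p \<le> \<lfloor>1 + ln (\<sigma> / \<alpha>) / ln \<alpha>'\<rfloor> \<Longrightarrow>
            \<bar>DT (a (p - 1))\<bar> * (\<Prod>j = 0..p - 2. DT (a' j)) > \<sigma>"
    using return_expansion by blast
  have "\<sigma> \<le> \<bar>DT (a (Suc k))\<bar> * (\<Prod>j = 0..k. DT (a' j))" for k
  proof (cases "int (k + 2) \<le> \<lfloor>1 + ln (\<sigma> / \<alpha>) / ln \<alpha>'\<rfloor>")
    case True
    then show ?thesis using early[of "k + 2"] by simp
  next
    case False
    have "1 + ln (\<sigma> / \<alpha>) / ln \<alpha>' < real (k + 2)" using False by linarith
    then have "ln (\<sigma> / \<alpha>) < real (Suc k) * ln \<alpha>'"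
      using params_0 by (simp add: field_simps)
    also have "\<dots> = ln (\<alpha>' ^ Suc k)" using params_0 by (subst ln_realpow) auto
    finally have "\<sigma> / \<alpha> < \<alpha>' ^ Suc k"
      using params_0 params_1 \<sigma> by (subst (asm) ln_less_cancel_iff) auto
    then have "\<sigma> \<le> \<alpha> * \<alpha>' ^ Suc k" using params_1 by (simp add: field_simps)
    also have "\<dots> \<le> \<bar>DT (a (Suc k))\<bar> * (\<Prod>j = 0..k. DT (a' j))"
    proof (rule mult_mono)
      show "\<alpha> \<le> \<bar>DT (a (Suc k))\<bar>" using DT_right_le[OF a_in[of "Suc k"]] params_1 by simp
      have "(\<Prod>j = 0..k. \<alpha>') \<le> (\<Prod>j = 0..k. DT (a' j))"
        using DT_left_ge[OF a'_in] params_0 by (intro prod_mono) auto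
      then show "\<alpha>' ^ Suc k \<le> (\<Prod>j = 0..k. DT (a' j))" by simp
    qed (use params_0 in auto)
    finally show ?thesis .
  qed
  then show ?thesis using that \<sigma> by auto
qed

text \<open>One step maps a gap in \<open>[a' 0, a 0]\<close> to the right branch. Either the image is still in
  \<open>[a' 0, a 0]\<close> and was stretched by \<open>\<sigma>\<close>, or it lies beyond \<open>a 0\<close>; then the stretching by \<open>DT (a' 0)\<close>
  makes up for a possible contraction in the next step, on the right branch. On the right of the
  cusp this uses \<open>\<bar>DT b\<^sub>1\<bar> \<ge> DT (a' 0)\<close>.\<close>

lemma gap_first_step:
  assumes g: "gap u v" and u: "a' 0 \<le> u" and v: "v \<le> a 0" and \<sigma>: "\<sigma> \<le> d_10" "\<sigma> \<le> \<alpha>'"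
  obtains p q where "gap p q" "x\<^sub>0 \<le> p"
    "q \<le> a 0 \<and> \<sigma> * (v - u) \<le> q - p \<or> a 0 \<le> p \<and> DT (a' 0) * (v - u) \<le> q - p"
proof -
  have uv: "u < v" using g by (auto simp: gap_def)
  have a0: "x\<^sub>0 < a 0" "a 0 < 1" using a_in[of 0] by auto
  from gap_avoids[OF g x0_Z] show ?thesis
  proof
    assume v: "v \<le> x\<^sub>0"
    have g': "gap (T u) (T v)" by (rule gap_image_left[OF g v])
    have p: "x\<^sub>0 \<le> T u"
      using T_left_less[of "a' 0" u] a'_in[of 0] u uv v T_a'_0 by (cases "a' 0 = u") auto
    have stretch: "DT (a' 0) * (v - u) \<le> T v - T u"
      by (rule left_stretch) (use a'_in[of 0] u uv v in auto)
    have "\<sigma> \<le> DT (a' 0)" using DT_left_ge[OF a'_in[of 0]] \<sigma> by simp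
    then have "\<sigma> * (v - u) \<le> DT (a' 0) * (v - u)" using uv by (intro mult_right_mono) auto
    with stretch gap_avoids[OF g' a_Z[of 0]] show ?thesis by (intro that[OF g' p]) auto
  next
    assume u: "x\<^sub>0 \<le> u"
    have g': "gap (T v) (T u)" by (rule gap_image_right[OF g u])
    have p: "x\<^sub>0 \<le> T v"
      using T_right_less[of v "a 0"] u uv v a0 T_a_0 by (cases "a 0 = v") auto
    from gap_avoids[OF g b1_Z] show ?thesis
    proof
      assume vb: "v \<le> b\<^sub>1"
      have "\<bar>DT b\<^sub>1\<bar> * (v - u) \<le> T u - T v"
        by (rule right_stretch) (use u uv vb b1_properties a0 in auto)
      moreover have "DT (a' 0) * (v - u) \<le> \<bar>DT b\<^sub>1\<bar> * (v - u)"
        using DT_b1 uv by (intro mult_right_mono) auto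
      moreover have "a 0 \<le> T v"
        using T_right_less[of v b\<^sub>1] u uv vb a0 b1_properties by (cases "b\<^sub>1 = v") auto
      ultimately show ?thesis by (intro that[OF g' p]) auto
    next
      assume bu: "b\<^sub>1 \<le> u"
      obtain z where z: "u < z" "z < v" "T v - T u = (v - u) * DT z"
        by (rule T_MVT[of u v]) (use u uv v a0 x0_bounds in auto)
      have zI: "z \<in> {b\<^sub>1<..<a 0}" using z bu v by auto
      have "d_10 \<le> \<bar>DT z\<bar>" unfolding d_10_def
        by (rule cINF_lower[OF _ zI]) (auto intro!: bdd_belowI[of _ 0])
      then have "\<sigma> \<le> - DT z" using DT_right_le[of z] params_1 zI b1_properties a0 \<sigma> by auto
      then have "\<sigma> * (v - u) \<le> - DT z * (v - u)" using uv by (intro mult_right_mono) auto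
      then have "\<sigma> * (v - u) \<le> T u - T v" using z(3) by (simp add: mult.commute)
      moreover have "T u \<le> a 0"
        using T_right_less[of b\<^sub>1 u] uv bu v a0 b1_properties by (cases "b\<^sub>1 = u") auto
      ultimately show ?thesis by (intro that[OF g' p]) auto
    qed
  qed
qed

text \<open>The first return of a gap to \<open>[a' 0, a 0]\<close>. If the gap leaves, it passes through
  \<open>[a k, a (k + 1)]\<close> for some \<open>k\<close> and then through the \<open>k\<close>-th cell of the left branch, from where it climbs back.\<close>

lemma gap_return:
  obtains \<sigma> where "1 < \<sigma>"
    "\<And>u v. gap u v \<Longrightarrow> a' 0 \<le> u \<Longrightarrow> v \<le> a 0 \<Longrightarrow>
       \<exists>u' v'. gap u' v' \<and> a' 0 \<le> u' \<and> v' \<le> a 0 \<and> \<sigma> * (v - u) \<le> v' - u'"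
proof -
  obtain \<sigma> where \<sigma>: "1 < \<sigma>" "\<sigma> \<le> d_10" "\<sigma> \<le> \<alpha>'"
    and late: "\<And>k. \<sigma> \<le> \<bar>DT (a (Suc k))\<bar> * (\<Prod>j = 0..k. DT (a' j))"
    using return_factor by blast
  have a0: "a' 0 < x\<^sub>0" "x\<^sub>0 < a 0" "a 0 < 1" using a_in[of 0] a'_in[of 0] by auto
  have "\<exists>u' v'. gap u' v' \<and> a' 0 \<le> u' \<and> v' \<le> a 0 \<and> \<sigma> * (v - u) \<le> v' - u'"
    if g: "gap u v" and I: "a' 0 \<le> u" "v \<le> a 0" for u v
  proof -
    have uv: "u < v" using g by (auto simp: gap_def)
    obtain p q where pq: "gap p q" "x\<^sub>0 \<le> p"
      "q \<le> a 0 \<and> \<sigma> * (v - u) \<le> q - p \<or> a 0 \<le> p \<and> DT (a' 0) * (v - u) \<le> q - p"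
      by (rule gap_first_step[OF g I \<sigma>(2,3)])
    from pq(3) show ?thesis
    proof
      assume "q \<le> a 0 \<and> \<sigma> * (v - u) \<le> q - p"
      then show ?thesis using pq a0 by (intro exI[of _ p] exI[of _ q]) auto
    next
      assume p: "a 0 \<le> p \<and> DT (a' 0) * (v - u) \<le> q - p"
      have q: "p < q" "q \<le> 1" using pq by (auto simp: gap_def)
      have g2: "gap (T q) (T p)" by (rule gap_image_right[OF pq(1,2)])
      have "T p \<le> x\<^sub>0" using T_right_less[of "a 0" p] p q a0 T_a_0 by (cases "a 0 = p") auto
      from gap_cell[OF g2 this] obtain k where k: "a' k \<le> T q" "T p \<le> T (a' k)" by blast
      from gap_climb[OF g2 k] obtain u' v' where r: "gap u' v'" "a' 0 \<le> u'" "v' \<le> x\<^sub>0"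
        "(\<Prod>j = 1..k. DT (a' j)) * (T p - T q) \<le> v' - u'" by blast
      have "q \<le> a (Suc k)"
        using T_right_less[of "a (Suc k)" q] a_in[of "Suc k"] q k by (force simp: T_a_Suc)
      then have s: "\<bar>DT (a (Suc k))\<bar> * (q - p) \<le> T p - T q"
        using a_in[of "Suc k"] pq q by (intro right_stretch) auto
      have pos: "0 \<le> (\<Prod>j = 1..k. DT (a' j))"
        using DT_left_ge[OF a'_in] params_0 by (intro prod_nonneg) (auto intro: order_trans[of 0 \<alpha>'])
      have "(\<Prod>j = 0..k. DT (a' j)) = DT (a' 0) * (\<Prod>j = 1..k. DT (a' j))"
        by (simp add: prod.atLeast_Suc_atMost)
      then have "\<sigma> * (v - u) \<le> \<bar>DT (a (Suc k))\<bar> * (DT (a' 0) * (\<Prod>j = 1..k. DT (a' j))) * (v - u)"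
        using late[of k] uv by (intro mult_right_mono) auto
      also have "\<dots> = (\<Prod>j = 1..k. DT (a' j)) * (\<bar>DT (a (Suc k))\<bar> * (DT (a' 0) * (v - u)))"
        by (simp add: mult_ac)
      also have "\<dots> \<le> (\<Prod>j = 1..k. DT (a' j)) * (\<bar>DT (a (Suc k))\<bar> * (q - p))"
        using p pos by (intro mult_left_mono) auto
      also have "\<dots> \<le> (\<Prod>j = 1..k. DT (a' j)) * (T p - T q)"
        by (rule mult_left_mono[OF s pos])
      finally show ?thesis using r a0 by (intro exI[of _ u'] exI[of _ v']) auto
    qed
  qed
  then show ?thesis using that \<sigma>(1) by blast
qed

lemma no_gap: "\<not> gap u v"
proof
  assume g: "gap u v"
  have a0: "a' 0 < x\<^sub>0" "x\<^sub>0 < a 0" "a 0 < 1" using a_in[of 0] a'_in[of 0] by auto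
  have left: "\<exists>u' v'. gap u' v' \<and> a' 0 \<le> u' \<and> v' \<le> a 0" if g: "gap u v" "v \<le> x\<^sub>0" for u v
  proof -
    obtain k where k: "a' k \<le> u" "v \<le> T (a' k)" by (rule gap_cell[OF g])
    from gap_climb[OF g(1) k] obtain u' v' where "gap u' v'" "a' 0 \<le> u'" "v' \<le> x\<^sub>0" by blast
    then show ?thesis using a0 by (intro exI[of _ u'] exI[of _ v']) auto
  qed
  have "\<exists>u' v'. gap u' v' \<and> a' 0 \<le> u' \<and> v' \<le> a 0"
    using gap_avoids[OF g x0_Z]
  proof
    assume u: "x\<^sub>0 \<le> u"
    have uv: "u < v" "v \<le> 1" using g by (auto simp: gap_def)
    from gap_avoids[OF g a_Z[of 0]] show ?thesis
    proof
      assume "v \<le> a 0"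
      then show ?thesis using g u a0 by (intro exI[of _ u] exI[of _ v]) auto
    next
      assume au: "a 0 \<le> u"
      have "T u \<le> x\<^sub>0" using T_right_less[of "a 0" u] au uv a0 T_a_0 by (cases "a 0 = u") auto
      then show ?thesis by (rule left[OF gap_image_right[OF g u]])
    qed
  qed (rule left[OF g])
  then obtain u0 v0 where g0: "gap u0 v0" "a' 0 \<le> u0" "v0 \<le> a 0" by blast
  obtain \<sigma> where \<sigma>: "1 < \<sigma>"
    and step: "\<And>u v. gap u v \<Longrightarrow> a' 0 \<le> u \<Longrightarrow> v \<le> a 0 \<Longrightarrow>
       \<exists>u' v'. gap u' v' \<and> a' 0 \<le> u' \<and> v' \<le> a 0 \<and> \<sigma> * (v - u) \<le> v' - u'"
    using gap_return by blast
  have grow: "\<exists>u v. gap u v \<and> a' 0 \<le> u \<and> v \<le> a 0 \<and> \<sigma> ^ n * (v0 - u0) \<le> v - u" for n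
  proof (induction n)
    case 0
    then show ?case using g0 by auto
  next
    case (Suc n)
    then obtain u v where uv: "gap u v" "a' 0 \<le> u" "v \<le> a 0" "\<sigma> ^ n * (v0 - u0) \<le> v - u" by blast
    from step[OF uv(1-3)] obtain u' v' where
      uv': "gap u' v'" "a' 0 \<le> u'" "v' \<le> a 0" "\<sigma> * (v - u) \<le> v' - u'" by blast
    have "\<sigma> ^ Suc n * (v0 - u0) \<le> \<sigma> * (v - u)"
      using mult_left_mono[OF uv(4), of \<sigma>] \<sigma> by (simp add: mult.assoc)
    with uv' show ?case by (intro exI[of _ u'] exI[of _ v']) auto
  qed
  have l0: "0 < v0 - u0" using g0 by (auto simp: gap_def)
  obtain n where "1 / (v0 - u0) < \<sigma> ^ n" using real_arch_pow[OF \<sigma>] by blast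
  then have "1 < \<sigma> ^ n * (v0 - u0)" using l0 by (simp add: field_simps)
  with grow[of n] show False by (auto simp: gap_def)
qed

end

section \<open>The Perron-Frobenius equation and positivity at the cusp\<close>

text \<open>A Lorenz-like cusp map with an absolutely continuous invariant probability measure and a density
  of it that is continuous on \<open>(0, 1)\<close>.\<close>

locale lorenz_cusp_density = lorenz_cusp_map +
  fixes \<mu> :: "real measure" and \<rho> :: "real \<Rightarrow> real"
  assumes acip: "acip T \<mu>"
    and density: "continuous_density \<mu> \<rho>"
begin

lemma \<rho>_nonneg: "x \<in> {0..1} \<Longrightarrow> 0 \<le> \<rho> x"
  using density by (auto simp: continuous_density_def)

lemma \<rho>_continuous: "continuous_on {0<..<1} \<rho>"
  using density by (auto simp: continuous_density_def)

lemma sets_\<mu>: "sets \<mu> = sets lborel01"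
  using acip by (simp add: acip_def)

lemma space_\<mu>: "space \<mu> = {0..1}"
  using sets_eq_imp_space_eq[OF sets_\<mu>] by simp

lemma prob_\<mu>: "prob_space \<mu>"
  using acip by (simp add: acip_def)

lemma interval_in_sets: "0 \<le> u \<Longrightarrow> v \<le> 1 \<Longrightarrow> {u..v} \<in> sets \<mu>"
  unfolding sets_\<mu> sets_restrict_space by (rule image_eqI[of _ _ "{u..v}"]) auto

lemma emeasure_\<mu>:
  assumes "S \<in> sets \<mu>"
  shows "emeasure \<mu> S = (\<integral>\<^sup>+ x. ennreal (indicator S x * \<rho> x) \<partial>lborel)"
proof -
  have m: "\<rho> \<in> borel_measurable lborel01" and \<mu>: "\<mu> = density lborel01 (\<lambda>x. ennreal (\<rho> x))"
    using density by (auto simp: continuous_density_def)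
  have S: "S \<in> sets lborel01" "S \<subseteq> {0..1}"
    using assms sets.sets_into_space[OF assms] by (auto simp: sets_\<mu> space_\<mu>)
  have "emeasure \<mu> S = (\<integral>\<^sup>+ x. ennreal (\<rho> x) * indicator S x \<partial>lborel01)"
    by (subst \<mu>) (rule emeasure_density, use m S in auto)
  also have "\<dots> = (\<integral>\<^sup>+ x. ennreal (\<rho> x) * indicator S x * indicator {0..1} x \<partial>lborel)"
    by (rule nn_integral_restrict_space) auto
  also have "\<dots> = (\<integral>\<^sup>+ x. ennreal (indicator S x * \<rho> x) \<partial>lborel)"
    by (rule nn_integral_cong) (use S(2) in \<open>auto simp: indicator_def\<close>)
  finally show ?thesis .
qed

lemma \<rho>_set_integrable: "set_integrable lborel {0..1} \<rho>"
proof -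
  have m: "(\<lambda>x. indicator {0..1} x *\<^sub>R \<rho> x) \<in> borel_measurable lborel"
    using density by (subst borel_measurable_restrict_space_iff[symmetric]) (auto simp: continuous_density_def)
  have "(\<integral>\<^sup>+ x. ennreal (indicator {0..1} x * \<rho> x) \<partial>lborel) = 1"
    using emeasure_\<mu>[of "{0..1}"] prob_space.emeasure_space_1[OF prob_\<mu>] sets.top[of \<mu>]
    by (simp add: space_\<mu>)
  then show ?thesis unfolding set_integrable_def
    using m \<rho>_nonneg by (intro integrableI_nonneg) (auto simp: indicator_def)
qed

lemma \<rho>_integrable: "\<rho> integrable_on {0..1}"
  by (rule set_borel_integral_eq_integral(1)[OF \<rho>_set_integrable])

lemma \<rho>_absolutely_integrable: "\<rho> absolutely_integrable_on {0..1}"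
  by (rule nonnegative_absolutely_integrable_1[OF \<rho>_integrable \<rho>_nonneg])

lemma measure_\<mu>:
  assumes "0 \<le> u" "v \<le> 1"
  shows "measure \<mu> {u..v} = integral {u..v} \<rho>"
proof -
  have i: "set_integrable lborel {u..v} \<rho>"
    by (rule set_integrable_subset[OF \<rho>_set_integrable]) (use assms in auto)
  have "emeasure \<mu> {u..v} = (\<integral>\<^sup>+ x. ennreal (indicator {u..v} x * \<rho> x) \<partial>lborel)"
    by (rule emeasure_\<mu>[OF interval_in_sets[OF assms]])
  also have "\<dots> = ennreal (LINT x:{u..v}|lborel. \<rho> x)"
    using i assms \<rho>_nonneg unfolding set_integrable_def set_lebesgue_integral_def real_scaleR_def
    by (intro nn_integral_eq_integral) (auto simp: indicator_def)
  also have "(LINT x:{u..v}|lborel. \<rho> x) = integral {u..v} \<rho>"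
    by (rule set_borel_integral_eq_integral(2)[OF i])
  finally have "emeasure \<mu> {u..v} = ennreal (integral {u..v} \<rho>)" .
  moreover have "0 \<le> integral {u..v} \<rho>"
    by (rule integral_nonneg[OF set_borel_integral_eq_integral(1)[OF i]]) (use assms \<rho>_nonneg in auto)
  ultimately show ?thesis by (simp add: measure_def)
qed

lemma invariance:
  assumes x: "x \<in> {0<..<1}"
  shows "integral {0..x} \<rho> = integral {0..left_inv x} \<rho> + integral {right_inv x..1} \<rho>"
proof -
  interpret prob_space \<mu> by (rule prob_\<mu>)
  have l: "left_inv x \<in> {0<..<x\<^sub>0}" "T (left_inv x) = x" using left_inv_open T_left_inv x by auto
  have r: "right_inv x \<in> {x\<^sub>0<..<1}" "T (right_inv x) = x" using right_inv_open T_right_inv x by auto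
  have eq: "T -` {0..x} \<inter> space \<mu> = {0..left_inv x} \<union> {right_inv x..1}" (is "?L = ?R")
  proof (intro set_eqI iffI)
    fix y assume y: "y \<in> ?L"
    then have y01: "0 \<le> y" "y \<le> 1" "T y \<le> x" by (auto simp: space_\<mu>)
    show "y \<in> ?R"
      using T_left_less[of "left_inv y" x] T_left_less[of "left_inv x" y] T_right_less[of y "right_inv x"] y01 l r
      by (cases "y \<le> x\<^sub>0") force+
  next
    fix y assume "y \<in> ?R"
    then show "y \<in> ?L"
    proof
      assume y: "y \<in> {0..left_inv x}"
      then have "T y \<le> T (left_inv x)" using T_left_less[of y "left_inv x"] l by (cases "y = left_inv x") auto
      moreover have "y \<in> {0..1}" using y l x0_bounds by auto
      ultimately show ?thesis using l T_in_unit[of y] by (auto simp: space_\<mu>)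
    next
      assume y: "y \<in> {right_inv x..1}"
      then have "T y \<le> T (right_inv x)" using T_right_less[of "right_inv x" y] r by (cases "y = right_inv x") auto
      moreover have "y \<in> {0..1}" using y r x0_bounds by auto
      ultimately show ?thesis using r T_in_unit[of y] by (auto simp: space_\<mu>)
    qed
  qed
  have T: "T \<in> measurable \<mu> \<mu>" "distr \<mu> \<mu> T = \<mu>" using acip by (auto simp: acip_def)
  have "integral {0..x} \<rho> = measure \<mu> {0..x}" using x by (simp add: measure_\<mu>)
  also have "\<dots> = measure (distr \<mu> \<mu> T) {0..x}" by (simp add: T(2))
  also have "\<dots> = measure \<mu> (T -` {0..x} \<inter> space \<mu>)"
    by (rule measure_distr[OF T(1)]) (use interval_in_sets x in auto)
  also have "\<dots> = measure \<mu> {0..left_inv x} + measure \<mu> {right_inv x..1}"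
    unfolding eq
    by (rule finite_measure_Union) (use interval_in_sets l r x0_bounds in auto)
  also have "\<dots> = integral {0..left_inv x} \<rho> + integral {right_inv x..1} \<rho>"
    using l r x0_bounds by (simp add: measure_\<mu>)
  finally show ?thesis .
qed

lemma perron_frobenius:
  assumes x: "x \<in> {0<..<1}"
  shows "\<rho> x = \<rho> (left_inv x) / DT (left_inv x) + \<rho> (right_inv x) / \<bar>DT (right_inv x)\<bar>"
proof -
  define R where "R = (\<lambda>x. integral {0..x} \<rho>)"
  have R: "(R has_real_derivative \<rho> y) (at y)" if "y \<in> {0<..<1}" for y
    unfolding R_def by (rule indefinite_integral_deriv[OF \<rho>_integrable \<rho>_continuous that])
  have eq: "R y = R (left_inv y) + (R 1 - R (right_inv y))" if y: "y \<in> {0<..<1}" for y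
    using invariance[OF y] integral_split[OF \<rho>_integrable, of "right_inv y" 1] right_inv_open[OF y] x0_bounds
    unfolding R_def by auto
  have l: "left_inv x \<in> {0<..<1}" and r: "right_inv x \<in> {x\<^sub>0<..<1}" "right_inv x \<in> {0<..<1}"
    using left_inv_open[OF x] right_inv_open[OF x] x0_bounds by auto
  have "((\<lambda>y. R (left_inv y) + (R 1 - R (right_inv y))) has_real_derivative
      (\<rho> (left_inv x) * inverse (DT (left_inv x)) + (0 - \<rho> (right_inv x) * inverse (DT (right_inv x))))) (at x)"
    by (intro DERIV_add DERIV_diff DERIV_const DERIV_chain2[OF R left_inv_deriv]
        DERIV_chain2[OF R right_inv_deriv] l r x)
  moreover have "\<forall>\<^sub>F y in nhds x. R y = R (left_inv y) + (R 1 - R (right_inv y))"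
  proof -
    have "\<forall>\<^sub>F y in nhds x. y \<in> {0<..<1}" by (rule eventually_nhds_in_open) (use x in auto)
    then show ?thesis by eventually_elim (rule eq)
  qed
  ultimately have "(R has_real_derivative
      (\<rho> (left_inv x) * inverse (DT (left_inv x)) + (0 - \<rho> (right_inv x) * inverse (DT (right_inv x))))) (at x)"
    by (subst DERIV_cong_ev[OF refl _ refl])
  from DERIV_unique[OF R[OF x] this] show ?thesis
    using DT_right_le[OF r(1)] params_1 by (simp add: divide_inverse)
qed

lemma \<rho>_somewhere_positive: "\<exists>y\<in>{0<..<1}. 0 < \<rho> y"
proof (rule ccontr)
  assume "\<not> ?thesis"
  then have zero: "\<rho> y = 0" if "y \<in> {0<..<1}" for y
    using \<rho>_nonneg[of y] that by force
  have "integral {0..1} \<rho> = integral {0..1} (\<lambda>_::real. 0)"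
  proof (rule integral_spike[of "{0, 1}"])
    show "0 = \<rho> x" if "x \<in> {0..1} - {0, 1}" for x using zero[of x] that by auto
  qed simp
  moreover have "integral {0..1} \<rho> = 1"
    using measure_\<mu>[of 0 1] prob_space.prob_space[OF prob_\<mu>] by (simp add: space_\<mu>)
  ultimately show False by simp
qed

text \<open>If \<open>\<rho>\<close> vanished at \<open>x\<^sub>0\<close>, its zero set would have no gaps.\<close>

lemma \<rho>_x0_pos: "0 < \<rho> x\<^sub>0"
proof (rule ccontr)
  assume "\<not> 0 < \<rho> x\<^sub>0"
  then have z: "\<rho> x\<^sub>0 = 0" using \<rho>_nonneg[of x\<^sub>0] x0_bounds by auto
  define Z where "Z = {x \<in> {0<..<1}. \<rho> x = 0}"
  have "backward_invariant T DT x\<^sub>0 \<alpha>' \<beta>' \<psi> \<alpha> \<beta> \<kappa> A' B' A B Z"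
  proof unfold_locales
    show "x\<^sub>0 \<in> Z" using z x0 by (simp add: Z_def)
  next
    fix x assume x: "x \<in> {0<..<1} - {x\<^sub>0}" and Tx: "T x \<in> Z"
    then have T01: "T x \<in> {0<..<1}" and T0: "\<rho> (T x) = 0" by (auto simp: Z_def)
    have l: "left_inv (T x) \<in> {0<..<x\<^sub>0}" and r: "right_inv (T x) \<in> {x\<^sub>0<..<1}"
      using left_inv_open right_inv_open T01 by auto
    have DTl: "0 < DT (left_inv (T x))" and DTr: "0 < \<bar>DT (right_inv (T x))\<bar>"
      using DT_left_ge[OF l] DT_right_le[OF r] params_0 params_1 by auto
    have "0 \<le> \<rho> (left_inv (T x)) / DT (left_inv (T x))" "0 \<le> \<rho> (right_inv (T x)) / \<bar>DT (right_inv (T x))\<bar>"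
      using \<rho>_nonneg l r DTl DTr x0_bounds by auto
    with perron_frobenius[OF T01] T0 have "\<rho> (left_inv (T x)) / DT (left_inv (T x)) = 0"
      "\<rho> (right_inv (T x)) / \<bar>DT (right_inv (T x))\<bar> = 0" by linarith+
    then have "\<rho> (left_inv (T x)) = 0" "\<rho> (right_inv (T x)) = 0" using DTl DTr by auto
    then have "\<rho> x = 0"
      using left_inv_T[of x] right_inv_T[of x] x by (cases "x \<le> x\<^sub>0") auto
    then show "x \<in> Z" using x by (auto simp: Z_def)
  qed
  then interpret backward_invariant T DT x\<^sub>0 \<alpha>' \<beta>' \<psi> \<alpha> \<beta> \<kappa> A' B' A B Z .
  obtain y where y: "y \<in> {0<..<1}" "0 < \<rho> y" using \<rho>_somewhere_positive by blast
  have "open (\<rho> -` {0<..} \<inter> {0<..<1})"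
    using \<rho>_continuous by (simp add: continuous_on_open_vimage)
  then obtain e where e: "0 < e" "ball y e \<subseteq> \<rho> -` {0<..} \<inter> {0<..<1}"
    by (rule openE[of _ y]) (use y in auto)
  have pos: "0 < \<rho> x \<and> 0 < x \<and> x < 1" if "\<bar>y - x\<bar> < e" for x
    using e(2) that by (auto simp: dist_real_def subset_iff)
  have "gap (y - e / 2) (y + e / 2)"
    unfolding gap_def
  proof (intro conjI)
    show "{y - e / 2<..<y + e / 2} \<inter> Z = {}"
    proof (intro equals0I)
      fix x assume "x \<in> {y - e / 2<..<y + e / 2} \<inter> Z"
      then have "\<bar>y - x\<bar> < e" "\<rho> x = 0" using e(1) by (auto simp: Z_def abs_if)
      with pos[of x] show False by simp
    qed
  qed (use pos[of "y - e / 2"] pos[of "y + e / 2"] e(1) in auto)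
  then show False using no_gap by blast
qed

end

section \<open>Asymptotics of the inverse branches\<close>

text \<open>With \<open>d\<close> the distance to the cusp, \<open>1 - T\<close> of order \<open>d powr b\<close> and the derivative of order
  \<open>d powr (b - 1)\<close>, the reciprocal of the derivative is of order \<open>(1 - T) powr (1 / b - 1)\<close>.\<close>

lemma cusp_jacobian_tendsto:
  fixes d T D :: "real \<Rightarrow> real"
  assumes T: "((\<lambda>y. (1 - T y) / d y powr b) \<longlongrightarrow> A) F" and D: "((\<lambda>y. D y / d y powr (b - 1)) \<longlongrightarrow> c) F"
    and pos: "0 < A" "0 < c" "0 < b"
    and ev: "\<forall>\<^sub>F y in F. 0 < d y \<and> T y < 1"
  shows "((\<lambda>y. 1 / D y / (1 - T y) powr (1 / b - 1)) \<longlongrightarrow> 1 / (c * A powr (1 / b - 1))) F"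
proof -
  have "((\<lambda>y. 1 / (D y / d y powr (b - 1) * ((1 - T y) / d y powr b) powr (1 / b - 1)))
      \<longlongrightarrow> 1 / (c * A powr (1 / b - 1))) F"
    by (intro tendsto_intros T D) (use pos in auto)
  then show ?thesis
  proof (rule Lim_transform_eventually)
    show "\<forall>\<^sub>F y in F. 1 / (D y / d y powr (b - 1) * ((1 - T y) / d y powr b) powr (1 / b - 1))
        = 1 / D y / (1 - T y) powr (1 / b - 1)"
      using ev
    proof eventually_elim
      case (elim y)
      have "(d y powr b) powr (1 / b - 1) = d y powr (1 - b)"
        using pos by (simp add: powr_powr right_diff_distrib)
      also have "\<dots> = 1 / d y powr (b - 1)"
        using elim by (simp add: powr_minus_divide[symmetric])
      finally have "((1 - T y) / d y powr b) powr (1 / b - 1) = (1 - T y) powr (1 / b - 1) * d y powr (b - 1)"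
        using elim by (simp add: powr_divide)
      then show ?case using elim by simp
    qed
  qed
qed

context cusp_map
begin

lemma left_inv_at_left_1: "filterlim left_inv (at_left x\<^sub>0) (at_left 1)"
proof (rule tendsto_imp_filterlim_at_left)
  have "(left_inv \<longlongrightarrow> left_inv 1) (at 1 within {0..1})"
    using left_inv_continuous by (auto simp: continuous_on_def)
  moreover have "left_inv 1 = x\<^sub>0" using left_inv_T[of x\<^sub>0] x0_bounds by (simp add: T_x0)
  ultimately show "(left_inv \<longlongrightarrow> x\<^sub>0) (at_left 1)" by (simp add: at_within_Icc_at_left)
  have "\<forall>\<^sub>F x in at_left 1. x \<in> {0<..<1::real}" by (rule eventually_at_left_real) simp
  then show "\<forall>\<^sub>F x in at_left 1. left_inv x < x\<^sub>0"
    by eventually_elim (use left_inv_open in auto)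
qed

lemma right_inv_at_left_1: "filterlim right_inv (at_right x\<^sub>0) (at_left 1)"
proof (rule tendsto_imp_filterlim_at_right)
  have "(right_inv \<longlongrightarrow> right_inv 1) (at 1 within {0..1})"
    using right_inv_continuous by (auto simp: continuous_on_def)
  moreover have "right_inv 1 = x\<^sub>0" using right_inv_T[of x\<^sub>0] x0_bounds by (simp add: T_x0)
  ultimately show "(right_inv \<longlongrightarrow> x\<^sub>0) (at_left 1)" by (simp add: at_within_Icc_at_left)
  have "\<forall>\<^sub>F x in at_left 1. x \<in> {0<..<1::real}" by (rule eventually_at_left_real) simp
  then show "\<forall>\<^sub>F x in at_left 1. x\<^sub>0 < right_inv x"
    by eventually_elim (use right_inv_open in auto)
qed

lemma left_inv_at_right_0: "filterlim left_inv (at_right 0) (at_right 0)"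
proof (rule tendsto_imp_filterlim_at_right)
  have "(left_inv \<longlongrightarrow> left_inv 0) (at 0 within {0..1})"
    using left_inv_continuous by (auto simp: continuous_on_def)
  moreover have "left_inv 0 = 0" using left_inv_T[of 0] x0_bounds by (simp add: T_0)
  ultimately show "(left_inv \<longlongrightarrow> 0) (at_right 0)" by (simp add: at_within_Icc_at_right)
  have "\<forall>\<^sub>F x in at_right 0. x \<in> {0<..<1::real}" by (rule eventually_at_right_real) simp
  then show "\<forall>\<^sub>F x in at_right 0. 0 < left_inv x"
    by eventually_elim (use left_inv_open in auto)
qed

lemma right_inv_at_right_0: "filterlim right_inv (at_left 1) (at_right 0)"
proof (rule tendsto_imp_filterlim_at_left)
  have "(right_inv \<longlongrightarrow> right_inv 0) (at 0 within {0..1})"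
    using right_inv_continuous by (auto simp: continuous_on_def)
  moreover have "right_inv 0 = 1" using right_inv_T[of 1] x0_bounds by (simp add: T_1)
  ultimately show "(right_inv \<longlongrightarrow> 1) (at_right 0)" by (simp add: at_within_Icc_at_right)
  have "\<forall>\<^sub>F x in at_right 0. x \<in> {0<..<1::real}" by (rule eventually_at_right_real) simp
  then show "\<forall>\<^sub>F x in at_right 0. right_inv x < 1"
    by eventually_elim (use right_inv_open in auto)
qed

lemma left_jacobian_at_1:
  obtains e where "0 < e" "((\<lambda>x. 1 / DT (left_inv x) / (1 - x) powr (1 / B' - 1)) \<longlongrightarrow> e) (at_left 1)"
proof -
  have ev: "\<forall>\<^sub>F y in at_left x\<^sub>0. y \<in> {0<..<x\<^sub>0}" by (rule eventually_at_left_real) (rule x0_bounds)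
  obtain c where c: "0 < c" "(\<lambda>x. DT x - c * (x\<^sub>0 - x) powr (B' - 1)) \<in> o[at_left x\<^sub>0](\<lambda>x. (x\<^sub>0 - x) powr (B' - 1))"
    using DT_left by blast
  have "(\<lambda>y. - ((1 - T y) - A' * (x\<^sub>0 - y) powr B')) \<in> o[at_left x\<^sub>0](\<lambda>y. (x\<^sub>0 - y) powr B')"
    using T_left by (simp add: algebra_simps)
  then have 1: "((\<lambda>y. (1 - T y) / (x\<^sub>0 - y) powr B') \<longlongrightarrow> A') (at_left x\<^sub>0)"
    unfolding landau_o.small.uminus_in_iff
    by (rule tendsto_ratio_of_smallo) (use ev in eventually_elim, auto)
  have 2: "((\<lambda>y. DT y / (x\<^sub>0 - y) powr (B' - 1)) \<longlongrightarrow> c) (at_left x\<^sub>0)"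
    by (rule tendsto_ratio_of_smallo[OF c(2)]) (use ev in eventually_elim, auto)
  have 3: "\<forall>\<^sub>F y in at_left x\<^sub>0. 0 < x\<^sub>0 - y \<and> T y < 1"
    using ev by eventually_elim (use T_left_less[of _ x\<^sub>0] T_x0 in auto)
  note lim = cusp_jacobian_tendsto[OF 1 2 params_left(1) c(1) params_left(2) 3]
  have "((\<lambda>x. 1 / DT (left_inv x) / (1 - T (left_inv x)) powr (1 / B' - 1))
      \<longlongrightarrow> 1 / (c * A' powr (1 / B' - 1))) (at_left 1)"
    by (rule filterlim_compose[OF lim left_inv_at_left_1])
  then have "((\<lambda>x. 1 / DT (left_inv x) / (1 - x) powr (1 / B' - 1)) \<longlongrightarrow> 1 / (c * A' powr (1 / B' - 1))) (at_left 1)"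
  proof (rule Lim_transform_eventually)
    have "\<forall>\<^sub>F x in at_left 1. x \<in> {0<..<1::real}" by (rule eventually_at_left_real) simp
    then show "\<forall>\<^sub>F x in at_left 1. 1 / DT (left_inv x) / (1 - T (left_inv x)) powr (1 / B' - 1)
       = 1 / DT (left_inv x) / (1 - x) powr (1 / B' - 1)"
      by eventually_elim (simp add: T_left_inv)
  qed
  moreover have "0 < 1 / (c * A' powr (1 / B' - 1))" using c params_left by simp
  ultimately show ?thesis using that by blast
qed

lemma right_jacobian_at_1:
  obtains e where "0 < e" "((\<lambda>x. 1 / \<bar>DT (right_inv x)\<bar> / (1 - x) powr (1 / B - 1)) \<longlongrightarrow> e) (at_left 1)"
proof -
  have ev: "\<forall>\<^sub>F y in at_right x\<^sub>0. y \<in> {x\<^sub>0<..<1}" by (rule eventually_at_right_real) (rule x0_bounds)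
  obtain c where c: "0 < c" "(\<lambda>x. DT x - (- c * (x - x\<^sub>0) powr (B - 1))) \<in> o[at_right x\<^sub>0](\<lambda>x. (x - x\<^sub>0) powr (B - 1))"
    using DT_right by blast
  have "(\<lambda>y. - ((1 - T y) - A * (y - x\<^sub>0) powr B)) \<in> o[at_right x\<^sub>0](\<lambda>y. (y - x\<^sub>0) powr B)"
    using T_right by (simp add: algebra_simps)
  then have 1: "((\<lambda>y. (1 - T y) / (y - x\<^sub>0) powr B) \<longlongrightarrow> A) (at_right x\<^sub>0)"
    unfolding landau_o.small.uminus_in_iff
    by (rule tendsto_ratio_of_smallo) (use ev in eventually_elim, auto)
  have "(\<lambda>y. - (- DT y - c * (y - x\<^sub>0) powr (B - 1))) \<in> o[at_right x\<^sub>0](\<lambda>y. (y - x\<^sub>0) powr (B - 1))"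
    using c(2) by (simp add: algebra_simps)
  then have "((\<lambda>y. - DT y / (y - x\<^sub>0) powr (B - 1)) \<longlongrightarrow> c) (at_right x\<^sub>0)"
    unfolding landau_o.small.uminus_in_iff
    by (rule tendsto_ratio_of_smallo) (use ev in eventually_elim, auto)
  then have 2: "((\<lambda>y. \<bar>DT y\<bar> / (y - x\<^sub>0) powr (B - 1)) \<longlongrightarrow> c) (at_right x\<^sub>0)"
  proof (rule Lim_transform_eventually)
    show "\<forall>\<^sub>F y in at_right x\<^sub>0. - DT y / (y - x\<^sub>0) powr (B - 1) = \<bar>DT y\<bar> / (y - x\<^sub>0) powr (B - 1)"
      using ev
    proof eventually_elim
      case (elim y)
      then have "\<bar>DT y\<bar> = - DT y" using DT_right_le[of y] params_1 by simp
      then show ?case by simp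
    qed
  qed
  have 3: "\<forall>\<^sub>F y in at_right x\<^sub>0. 0 < y - x\<^sub>0 \<and> T y < 1"
    using ev by eventually_elim (use T_right_less[of x\<^sub>0] T_x0 in auto)
  note lim = cusp_jacobian_tendsto[OF 1 2 params_right(1) c(1) params_right(2) 3]
  have "((\<lambda>x. 1 / \<bar>DT (right_inv x)\<bar> / (1 - T (right_inv x)) powr (1 / B - 1))
      \<longlongrightarrow> 1 / (c * A powr (1 / B - 1))) (at_left 1)"
    by (rule filterlim_compose[OF lim right_inv_at_left_1])
  then have "((\<lambda>x. 1 / \<bar>DT (right_inv x)\<bar> / (1 - x) powr (1 / B - 1)) \<longlongrightarrow> 1 / (c * A powr (1 / B - 1))) (at_left 1)"
  proof (rule Lim_transform_eventually)
    have "\<forall>\<^sub>F x in at_left 1. x \<in> {0<..<1::real}" by (rule eventually_at_left_real) simp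
    then show "\<forall>\<^sub>F x in at_left 1. 1 / \<bar>DT (right_inv x)\<bar> / (1 - T (right_inv x)) powr (1 / B - 1)
       = 1 / \<bar>DT (right_inv x)\<bar> / (1 - x) powr (1 / B - 1)"
      by eventually_elim (simp add: T_right_inv)
  qed
  moreover have "0 < 1 / (c * A powr (1 / B - 1))" using c params_right by simp
  ultimately show ?thesis using that by blast
qed

lemma T_slope_at_0: "((\<lambda>y. T y / y) \<longlongrightarrow> \<alpha>') (at_right 0)"
proof -
  have ev: "\<forall>\<^sub>F y in at_right 0. y \<in> {0<..<x\<^sub>0}" by (rule eventually_at_right_real) (rule x0_bounds)
  have "(DT \<longlongrightarrow> DT 0) (at 0 within {0..1} - {x\<^sub>0})"
    using deriv_continuous x0_bounds by (auto simp: continuous_on_def)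
  then have "(DT \<longlongrightarrow> DT 0) (at 0 within {0..<x\<^sub>0})"
    by (rule tendsto_within_subset) (use x0_bounds in auto)
  moreover have "at 0 within {0..<x\<^sub>0} = at_right 0"
    by (rule at_within_nhd[of _ "{..<x\<^sub>0}"]) (use x0_bounds in auto)
  ultimately have "(DT \<longlongrightarrow> DT 0) (at_right 0)" by simp
  then have "DT 0 = \<alpha>'" using DT_tendsto_0 by (intro tendsto_unique) auto
  moreover have "(T has_real_derivative DT 0) (at 0 within {0..1})" using deriv[of 0] x0_bounds by simp
  ultimately show ?thesis by (simp add: has_field_derivative_iff T_0 at_within_Icc_at_right)
qed

lemma T_slope_at_1: "((\<lambda>y. T y / (1 - y)) \<longlongrightarrow> \<alpha>) (at_left 1)"
proof -
  have "(DT \<longlongrightarrow> DT 1) (at 1 within {0..1} - {x\<^sub>0})"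
    using deriv_continuous x0_bounds by (auto simp: continuous_on_def)
  then have "(DT \<longlongrightarrow> DT 1) (at 1 within {x\<^sub>0<..1})"
    by (rule tendsto_within_subset) (use x0_bounds in auto)
  moreover have "at 1 within {x\<^sub>0<..1} = at_left 1"
    by (rule at_within_nhd[of _ "{x\<^sub>0<..}"]) (use x0_bounds in auto)
  ultimately have "(DT \<longlongrightarrow> DT 1) (at_left 1)" by simp
  then have "DT 1 = - \<alpha>" using DT_tendsto_1 by (intro tendsto_unique) auto
  moreover have "(T has_real_derivative DT 1) (at 1 within {0..1})" using deriv[of 1] x0_bounds by simp
  ultimately have "((\<lambda>y. T y / (y - 1)) \<longlongrightarrow> - \<alpha>) (at_left 1)"
    by (simp add: has_field_derivative_iff T_1 at_within_Icc_at_left)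
  from tendsto_minus[OF this] show ?thesis by (simp flip: divide_minus_right)
qed

end

section \<open>Asymptotics of the density\<close>

context lorenz_cusp_density
begin

lemma \<rho>_tendsto_x0: "(\<rho> \<longlongrightarrow> \<rho> x\<^sub>0) (at x\<^sub>0)"
  using \<rho>_continuous x0 by (simp add: continuous_on_eq_continuous_at isCont_def)

text \<open>Of the two terms of the Perron-Frobenius equation, the one whose exponent is \<open>max B B'\<close>
  dominates; if \<open>B = B'\<close>, both contribute to the constant.\<close>

lemma density_at_1:
  fixes q :: real
  assumes q: "q = 1 / max B B' - 1"
  obtains c where "0 < c" "((\<lambda>x. \<rho> x / (1 - x) powr q) \<longlongrightarrow> c) (at_left 1)"
proof -
  obtain e where e: "0 < e" "((\<lambda>x. 1 / DT (left_inv x) / (1 - x) powr (1 / B' - 1)) \<longlongrightarrow> e) (at_left 1)"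
    by (rule left_jacobian_at_1)
  obtain e' where e': "0 < e'" "((\<lambda>x. 1 / \<bar>DT (right_inv x)\<bar> / (1 - x) powr (1 / B - 1)) \<longlongrightarrow> e') (at_left 1)"
    by (rule right_jacobian_at_1)
  define s where "s = (1 / B' - 1) - q"
  define s' where "s' = (1 / B - 1) - q"
  have s: "0 \<le> s" "0 \<le> s'" "s = 0 \<or> s' = 0"
    using params_left params_right unfolding s_def s'_def q by (auto simp: max_def frac_le)
  have \<rho>l: "((\<lambda>x. \<rho> (left_inv x)) \<longlongrightarrow> \<rho> x\<^sub>0) (at_left 1)"
    by (rule filterlim_compose[OF _ left_inv_at_left_1])
       (rule tendsto_within_subset[OF \<rho>_tendsto_x0], simp)
  have \<rho>r: "((\<lambda>x. \<rho> (right_inv x)) \<longlongrightarrow> \<rho> x\<^sub>0) (at_left 1)"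
    by (rule filterlim_compose[OF _ right_inv_at_left_1])
       (rule tendsto_within_subset[OF \<rho>_tendsto_x0], simp)
  \<comment> \<open>\<open>s\<close> and \<open>s'\<close> are the excesses of the two exponents over \<open>q\<close>; a positive excess kills the term\<close>
  define c where "c = \<rho> x\<^sub>0 * e * (if s = 0 then 1 else 0) + \<rho> x\<^sub>0 * e' * (if s' = 0 then 1 else 0)"
  have "((\<lambda>x. \<rho> (left_inv x) * (1 / DT (left_inv x) / (1 - x) powr (1 / B' - 1)) * (1 - x) powr s
      + \<rho> (right_inv x) * (1 / \<bar>DT (right_inv x)\<bar> / (1 - x) powr (1 / B - 1)) * (1 - x) powr s') \<longlongrightarrow> c) (at_left 1)"
    unfolding c_def by (intro tendsto_add tendsto_mult \<rho>l \<rho>r e e' powr_scale_tendsto_left s)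
  then have "((\<lambda>x. \<rho> x / (1 - x) powr q) \<longlongrightarrow> c) (at_left 1)"
  proof (rule Lim_transform_eventually)
    have "\<forall>\<^sub>F x in at_left 1. x \<in> {0<..<1::real}" by (rule eventually_at_left_real) simp
    then show "\<forall>\<^sub>F x in at_left 1. \<rho> (left_inv x) * (1 / DT (left_inv x) / (1 - x) powr (1 / B' - 1)) * (1 - x) powr s
      + \<rho> (right_inv x) * (1 / \<bar>DT (right_inv x)\<bar> / (1 - x) powr (1 / B - 1)) * (1 - x) powr s' = \<rho> x / (1 - x) powr q"
    proof eventually_elim
      case (elim x)
      have "(1 - x) powr s = (1 - x) powr (1 / B' - 1) / (1 - x) powr q"
        "(1 - x) powr s' = (1 - x) powr (1 / B - 1) / (1 - x) powr q"
        unfolding s_def s'_def by (rule powr_diff)+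
      then show ?case using elim by (simp add: perron_frobenius[OF elim] add_divide_distrib)
    qed
  qed
  moreover have "0 < c" using s(3) e(1) e'(1) \<rho>_x0_pos unfolding c_def by (auto simp: add_pos_pos)
  ultimately show ?thesis using that by blast
qed

text \<open>The positive part of \<open>h\<close> satisfies the hypotheses of \<open>subinvariant_zero\<close> for the left inverse branch.\<close>

lemma eventually_nonpos:
  fixes h :: "real \<Rightarrow> real"
  assumes int: "h absolutely_integrable_on {0..1}" and cont: "continuous_on {0<..<1} h"
    and sub: "\<forall>\<^sub>F x in at_right 0. h x \<le> h (left_inv x) / DT (left_inv x)"
  shows "\<forall>\<^sub>F x in at_right 0. h x \<le> 0"
proof -
  from sub obtain \<delta>' where \<delta>': "0 < \<delta>'" "\<And>x. 0 < x \<Longrightarrow> x < \<delta>' \<Longrightarrow> h x \<le> h (left_inv x) / DT (left_inv x)"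
    by (auto simp: eventually_at_right_field)
  define \<delta> where "\<delta> = min \<delta>' 1"
  have \<delta>: "0 < \<delta>" "\<delta> \<le> 1" "\<delta> \<le> \<delta>'" using \<delta>' by (auto simp: \<delta>_def)
  define f where "f = (\<lambda>x. max 0 (h x))"
  have "f absolutely_integrable_on {0..1}"
    unfolding f_def by (intro absolutely_integrable_max_1 int) simp
  then have "f integrable_on {0..1}" by (simp add: absolutely_integrable_on_def)
  then have f_int: "f integrable_on {0..\<delta>}" by (rule integrable_on_subinterval) (use \<delta> in auto)
  have f_cont: "continuous_on {0<..<\<delta>} f"
    unfolding f_def
    by (intro continuous_on_max continuous_on_const continuous_on_subset[OF cont]) (use \<delta> in auto)
  have "f z = 0" if z: "z \<in> {0<..<\<delta>}" for z
  proof (rule subinvariant_zero[OF f_int f_cont, of left_inv "\<lambda>x. inverse (DT (left_inv x))"])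
    fix x assume x: "x \<in> {0<..<\<delta>}"
    then have x01: "x \<in> {0<..<1}" using \<delta> by auto
    show "0 < left_inv x \<and> left_inv x < x" by (rule left_inv_bounds[OF x01])
    show "(left_inv has_real_derivative inverse (DT (left_inv x))) (at x)" by (rule left_inv_deriv[OF x01])
    have pos: "0 < DT (left_inv x)" using DT_left_ge[OF left_inv_open[OF x01]] params_0 by simp
    have "h x \<le> h (left_inv x) * inverse (DT (left_inv x))"
      using \<delta>'(2)[of x] x \<delta> by (simp add: divide_inverse)
    also have "\<dots> \<le> f (left_inv x) * inverse (DT (left_inv x))"
      unfolding f_def using pos by (intro mult_right_mono) auto
    finally have "h x \<le> f (left_inv x) * inverse (DT (left_inv x))" .
    moreover have "0 \<le> f (left_inv x) * inverse (DT (left_inv x))" using pos by (simp add: f_def)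
    ultimately show "f x \<le> f (left_inv x) * inverse (DT (left_inv x))" by (simp add: f_def)
  qed (use z in \<open>simp_all add: f_def\<close>)
  then have h: "h z \<le> 0" if "z \<in> {0<..<\<delta>}" for z
    using that by (metis f_def max.cobounded2)
  have "\<forall>\<^sub>F x in at_right 0. x \<in> {0<..<\<delta>}" by (rule eventually_at_right_real[OF \<delta>(1)])
  then show ?thesis by eventually_elim (rule h)
qed

text \<open>Let \<open>E\<close> be the factor of \<open>\<rho> (left_inv x) / (left_inv x) powr q\<close>, and \<open>G\<close> the contribution of the
  right preimage, in the Perron-Frobenius equation divided by \<open>x powr q\<close>. They tend to \<open>\<theta>\<close> and \<open>K\<close>.
  Replacing \<open>\<rho>\<close> by \<open>\<rho> x - D * x powr q\<close> leaves the defect \<open>(D * E x + G x - D) * x powr q\<close>, whose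
  sign near \<open>0\<close> is that of \<open>K / (1 - \<theta>) - D\<close>.\<close>

lemma density_at_0:
  assumes q: "0 < q" and c: "((\<lambda>x. \<rho> x / (1 - x) powr q) \<longlongrightarrow> c) (at_left 1)"
  shows "((\<lambda>x. \<rho> x / x powr q) \<longlongrightarrow> c * (1 / \<alpha>) powr (q + 1) / (1 - (1 / \<alpha>') powr (q + 1))) (at_right 0)"
proof -
  define \<theta> where "\<theta> = (1 / \<alpha>') powr (q + 1)"
  define K where "K = c * (1 / \<alpha>) powr (q + 1)"
  define E where "E = (\<lambda>x. (left_inv x / x) powr q / DT (left_inv x))"
  define G where "G = (\<lambda>x. \<rho> (right_inv x) / \<bar>DT (right_inv x)\<bar> / x powr q)"
  have ev: "\<forall>\<^sub>F x in at_right 0. x \<in> {0<..<1::real}" by (rule eventually_at_right_real) simp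
  have \<theta>: "\<theta> < 1"
  proof -
    have "(1 / \<alpha>') powr (q + 1) < 1 powr (q + 1)"
      using params_0 q by (intro powr_less_mono2) auto
    then show ?thesis by (simp add: \<theta>_def)
  qed
  have E_lim: "(E \<longlongrightarrow> \<theta>) (at_right 0)"
  proof -
    have "((\<lambda>y. 1 / (T y / y) powr q / DT y) \<longlongrightarrow> 1 / \<alpha>' powr q / \<alpha>') (at_right 0)"
      by (intro tendsto_intros T_slope_at_0 DT_tendsto_0) (use params_0 in auto)
    from filterlim_compose[OF this left_inv_at_right_0]
    have "((\<lambda>x. 1 / (T (left_inv x) / left_inv x) powr q / DT (left_inv x)) \<longlongrightarrow> 1 / \<alpha>' powr q / \<alpha>') (at_right 0)" .
    moreover have "1 / \<alpha>' powr q / \<alpha>' = \<theta>"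
      using params_0 by (simp add: \<theta>_def powr_divide powr_add)
    ultimately have "((\<lambda>x. 1 / (T (left_inv x) / left_inv x) powr q / DT (left_inv x)) \<longlongrightarrow> \<theta>) (at_right 0)" by simp
    then show ?thesis
    proof (rule Lim_transform_eventually)
      show "\<forall>\<^sub>F x in at_right 0. 1 / (T (left_inv x) / left_inv x) powr q / DT (left_inv x) = E x"
        using ev
      proof eventually_elim
        case (elim x)
        have "T (left_inv x) = x" "0 < left_inv x" using T_left_inv left_inv_open[of x] elim by auto
        then show ?case using elim by (simp add: E_def powr_divide)
      qed
    qed
  qed
  have G_lim: "(G \<longlongrightarrow> K) (at_right 0)"
  proof -
    have "((\<lambda>y. \<rho> y / (1 - y) powr q / (T y / (1 - y)) powr q / \<bar>DT y\<bar>) \<longlongrightarrow> c / \<alpha> powr q / \<bar>- \<alpha>\<bar>) (at_left 1)"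
      by (intro tendsto_intros c T_slope_at_1 DT_tendsto_1) (use params_1 in auto)
    from filterlim_compose[OF this right_inv_at_right_0]
    have "((\<lambda>x. \<rho> (right_inv x) / (1 - right_inv x) powr q / (T (right_inv x) / (1 - right_inv x)) powr q / \<bar>DT (right_inv x)\<bar>)
       \<longlongrightarrow> c / \<alpha> powr q / \<bar>- \<alpha>\<bar>) (at_right 0)" .
    moreover have "c / \<alpha> powr q / \<bar>- \<alpha>\<bar> = K"
      using params_1 by (simp add: K_def powr_divide powr_add)
    ultimately have "((\<lambda>x. \<rho> (right_inv x) / (1 - right_inv x) powr q / (T (right_inv x) / (1 - right_inv x)) powr q / \<bar>DT (right_inv x)\<bar>)
       \<longlongrightarrow> K) (at_right 0)" by simp
    then show ?thesis
    proof (rule Lim_transform_eventually)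
      show "\<forall>\<^sub>F x in at_right 0. \<rho> (right_inv x) / (1 - right_inv x) powr q / (T (right_inv x) / (1 - right_inv x)) powr q / \<bar>DT (right_inv x)\<bar> = G x"
        using ev
      proof eventually_elim
        case (elim x)
        have "T (right_inv x) = x" "right_inv x < 1" using T_right_inv right_inv_open[of x] elim by auto
        then show ?case using elim by (simp add: G_def powr_divide)
      qed
    qed
  qed
  have E_eq: "(left_inv x) powr q / DT (left_inv x) = E x * x powr q" if "x \<in> {0<..<1}" for x
    using that left_inv_open[OF that] by (simp add: E_def powr_divide)
  have pf: "\<rho> x = \<rho> (left_inv x) / DT (left_inv x) + G x * x powr q" if "x \<in> {0<..<1}" for x
    using perron_frobenius[OF that] that by (simp add: G_def)
  have defect: "\<rho> x - D * x powr q = (\<rho> (left_inv x) - D * left_inv x powr q) / DT (left_inv x)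
      + (D * E x + G x - D) * x powr q" if "x \<in> {0<..<1}" for D x
  proof -
    have "D * left_inv x powr q / DT (left_inv x) = D * E x * x powr q"
      using E_eq[OF that] by (simp only: times_divide_eq_right[symmetric] mult.assoc)
    then show ?thesis using pf[OF that] by (simp add: diff_divide_distrib algebra_simps)
  qed
  have defect_lim: "((\<lambda>x. D * E x + G x - D) \<longlongrightarrow> D * \<theta> + K - D) (at_right 0)" for D
    by (intro tendsto_intros E_lim G_lim)
  have powr_cont: "continuous_on {0..1} (\<lambda>x::real. D * x powr q)" for D
    by (intro continuous_on_mult continuous_on_const continuous_on_id continuous_on_powr') (use q in auto)
  have powr_int: "(\<lambda>x::real. D * x powr q) absolutely_integrable_on {0..1}" for D
    by (rule absolutely_integrable_continuous_real[OF powr_cont])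
  have powr_cont': "continuous_on {0<..<1} (\<lambda>x::real. D * x powr q)" for D
    by (rule continuous_on_subset[OF powr_cont]) auto
  have upper: "\<forall>\<^sub>F x in at_right 0. \<rho> x / x powr q \<le> D" if D: "K / (1 - \<theta>) < D" for D
  proof -
    have "D * \<theta> + K - D < 0" using D \<theta> by (simp add: field_simps)
    then have "\<forall>\<^sub>F x in at_right 0. D * E x + G x - D < 0" by (rule order_tendstoD(2)[OF defect_lim])
    then have "\<forall>\<^sub>F x in at_right 0. \<rho> x - D * x powr q \<le> (\<rho> (left_inv x) - D * left_inv x powr q) / DT (left_inv x)"
      using ev
    proof eventually_elim
      case (elim x)
      have "(D * E x + G x - D) * x powr q \<le> 0" using elim by (intro mult_nonpos_nonneg) auto
      then show ?case unfolding defect[OF elim(2)] by simp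
    qed
    from eventually_nonpos[OF _ _ this]
    have "\<forall>\<^sub>F x in at_right 0. \<rho> x - D * x powr q \<le> 0"
      by (simp add: \<rho>_absolutely_integrable powr_int set_integral_diff continuous_on_diff \<rho>_continuous powr_cont')
    then show ?thesis using ev by eventually_elim (simp add: divide_le_eq)
  qed
  have lower: "\<forall>\<^sub>F x in at_right 0. D \<le> \<rho> x / x powr q" if D: "D < K / (1 - \<theta>)" for D
  proof -
    have "0 < D * \<theta> + K - D" using D \<theta> by (simp add: field_simps)
    then have "\<forall>\<^sub>F x in at_right 0. 0 < D * E x + G x - D" by (rule order_tendstoD(1)[OF defect_lim])
    then have "\<forall>\<^sub>F x in at_right 0. D * x powr q - \<rho> x \<le> (D * left_inv x powr q - \<rho> (left_inv x)) / DT (left_inv x)"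
      using ev
    proof eventually_elim
      case (elim x)
      have "0 \<le> (D * E x + G x - D) * x powr q" using elim by (intro mult_nonneg_nonneg) auto
      moreover have "(D * left_inv x powr q - \<rho> (left_inv x)) / DT (left_inv x)
          = - ((\<rho> (left_inv x) - D * left_inv x powr q) / DT (left_inv x))"
        by (simp add: minus_divide_left)
      ultimately show ?case using defect[OF elim(2), of D] by linarith
    qed
    from eventually_nonpos[OF _ _ this]
    have "\<forall>\<^sub>F x in at_right 0. D * x powr q - \<rho> x \<le> 0"
      by (simp add: \<rho>_absolutely_integrable powr_int set_integral_diff continuous_on_diff \<rho>_continuous powr_cont')
    then show ?thesis using ev by eventually_elim (simp add: le_divide_eq)
  qed
  have "((\<lambda>x. \<rho> x / x powr q) \<longlongrightarrow> K / (1 - \<theta>)) (at_right 0)"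
  proof (rule order_tendstoI)
    fix D assume "D < K / (1 - \<theta>)"
    then obtain D' where D': "D < D'" "D' < K / (1 - \<theta>)" using dense by blast
    from lower[OF D'(2)] show "\<forall>\<^sub>F x in at_right 0. D < \<rho> x / x powr q"
      by eventually_elim (use D'(1) in simp)
  next
    fix D assume "K / (1 - \<theta>) < D"
    then obtain D' where D': "K / (1 - \<theta>) < D'" "D' < D" using dense by blast
    from upper[OF D'(1)] show "\<forall>\<^sub>F x in at_right 0. \<rho> x / x powr q < D"
      by eventually_elim (use D'(2) in simp)
  qed
  then show ?thesis by (simp add: K_def \<theta>_def)
qed

end

theorem proposition4:
  fixes T DT \<rho> :: "real \<Rightarrow> real"
    and x\<^sub>0 \<alpha>' \<beta>' \<psi> \<alpha> \<beta> \<kappa> A' B' A B Bs :: real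
    and \<mu> :: "real measure"
  assumes "lorenz_cusp_map T DT x\<^sub>0 \<alpha>' \<beta>' \<psi> \<alpha> \<beta> \<kappa> A' B' A B"
    and "acip T \<mu>"
    and "continuous_density \<mu> \<rho>"
    and "Bs = max B B'"
  shows "\<exists>c' c'' a b. c' > 0 \<and> c'' > 0 \<and> a > 0 \<and> b > 0 \<and>
           (\<lambda>x. \<rho> x - c' * x powr a) \<in> o[at_right 0](\<lambda>x. x powr a) \<and>
           (\<lambda>x. \<rho> x - c'' * (1 - x) powr b) \<in> o[at_left 1](\<lambda>x. (1 - x) powr b) \<and>
           a = 1 / Bs - 1 \<and> b = 1 / Bs - 1 \<and>
           (1 / \<alpha>') powr (1 / Bs) + (1 / (\<alpha> * (c' / c'') powr Bs)) powr (1 / Bs) = 1"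
proof -
  interpret lorenz_cusp_density T DT x\<^sub>0 \<alpha>' \<beta>' \<psi> \<alpha> \<beta> \<kappa> A' B' A B \<mu> \<rho>
    using assms(1-3) by (simp add: lorenz_cusp_density_def lorenz_cusp_density_axioms_def)
  define q where "q = 1 / Bs - 1"
  have Bs: "0 < Bs" "Bs < 1" using params_left params_right assms(4) by auto
  then have q: "0 < q" by (simp add: q_def)
  have q1: "q + 1 = 1 / Bs" by (simp add: q_def)
  obtain c'' where c'': "0 < c''" "((\<lambda>x. \<rho> x / (1 - x) powr q) \<longlongrightarrow> c'') (at_left 1)"
    using density_at_1[of q] assms(4) by (auto simp: q_def)
  define \<theta> where "\<theta> = (1 / \<alpha>') powr (1 / Bs)"
  define c' where "c' = c'' * (1 / \<alpha>) powr (1 / Bs) / (1 - \<theta>)"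
  have lim0: "((\<lambda>x. \<rho> x / x powr q) \<longlongrightarrow> c') (at_right 0)"
    using density_at_0[OF q c''(2)] unfolding q1 c'_def \<theta>_def .
  have \<theta>: "\<theta> < 1"
  proof -
    have "(1 / \<alpha>') powr (1 / Bs) < 1 powr (1 / Bs)"
      using params_0 Bs by (intro powr_less_mono2) auto
    then show ?thesis by (simp add: \<theta>_def)
  qed
  have c': "0 < c'" using c'' \<theta> params_1 by (simp add: c'_def)
  have 0: "(\<lambda>x. \<rho> x - c' * x powr q) \<in> o[at_right 0](\<lambda>x. x powr q)"
  proof (rule smallo_of_tendsto_ratio[OF lim0])
    have "\<forall>\<^sub>F x in at_right 0. x \<in> {0<..<1::real}" by (rule eventually_at_right_real) simp
    then show "\<forall>\<^sub>F x::real in at_right 0. x powr q \<noteq> 0" by eventually_elim simp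
  qed
  have 1: "(\<lambda>x. \<rho> x - c'' * (1 - x) powr q) \<in> o[at_left 1](\<lambda>x. (1 - x) powr q)"
  proof (rule smallo_of_tendsto_ratio[OF c''(2)])
    have "\<forall>\<^sub>F x in at_left 1. x \<in> {0<..<1::real}" by (rule eventually_at_left_real) simp
    then show "\<forall>\<^sub>F x::real in at_left 1. (1 - x) powr q \<noteq> 0" by eventually_elim simp
  qed
  have "(1 / (\<alpha> * (c' / c'') powr Bs)) powr (1 / Bs)
      = (1 / \<alpha>) powr (1 / Bs) / ((c' / c'') powr Bs) powr (1 / Bs)"
    using params_1 by (simp add: powr_divide powr_mult)
  also have "((c' / c'') powr Bs) powr (1 / Bs) = c' / c''"
    using Bs c' c'' by (simp add: powr_powr)
  also have "(1 / \<alpha>) powr (1 / Bs) / (c' / c'') = 1 - \<theta>"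
    using c''(1) \<theta> params_1 by (simp add: c'_def)
  finally have "(1 / \<alpha>') powr (1 / Bs) + (1 / (\<alpha> * (c' / c'') powr Bs)) powr (1 / Bs) = 1"
    by (simp add: \<theta>_def)
  with 0 1 c' c''(1) q show ?thesis unfolding q_def by blast
qed

end
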